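(* For every integer $k\geq 5$ there exists a function $\varepsilon_k:\mathbb{Z}_{>0}\to\mathbb{R}$ with $\varepsilon_k(n)\to 0$ as $n\to\infty$ such that for every positive integer $n$ there exists a graph $G$ with exactly $n$ vertices that is a Hasse diagram, has girth at least $k$, and has chromatic number $\chi(G)\geq n^{\frac{1}{2k-3}+\varepsilon_k(n)}$.
   Context: Given a finite partially ordered set $(P,<)$, its Hasse diagram (cover graph) is the undirected graph on vertex set $P$ in which $x$ and $y$ are joined by an edge if $x<y$ and there is no $z\in P$ with $x<z<y$. A graph is called a Hasse diagram if it is the Hasse diagram of some finite partially ordered set. The girth of a graph is the length of its shortest cycle (infinite if the graph has no cycle). $\chi(G)$ denotes the chromatic number of $G$. *)

theory Defs
  imports Complex_Main "HOL-Library.Extended_Nat" "Graph_Theory.Graph_Theory"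
begin

text \<open>
  Finite simple undirected graphs are the \<^locale>\<open>pair_graph\<close>s of the Graph Theory library:
  an undirected edge is represented by its two opposite arcs.
\<close>

definition strict_poset :: "'a set \<Rightarrow> ('a \<Rightarrow> 'a \<Rightarrow> bool) \<Rightarrow> bool" where
  "strict_poset P lt \<longleftrightarrow> irreflp_on P lt \<and> transp_on P lt"

definition covered_by :: "'a set \<Rightarrow> ('a \<Rightarrow> 'a \<Rightarrow> bool) \<Rightarrow> 'a \<Rightarrow> 'a \<Rightarrow> bool" where
  "covered_by P lt x y \<longleftrightarrow> x \<in> P \<and> y \<in> P \<and> lt x y \<and> \<not> (\<exists>z\<in>P. lt x z \<and> lt z y)"

definition cover_graph :: "'a set \<Rightarrow> ('a \<Rightarrow> 'a \<Rightarrow> bool) \<Rightarrow> 'a pair_pre_digraph" where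
  "cover_graph P lt =
     \<lparr> pverts = P, parcs = {(x, y). covered_by P lt x y \<or> covered_by P lt y x} \<rparr>"

definition is_hasse_diagram :: "'a pair_pre_digraph \<Rightarrow> bool" where
  "is_hasse_diagram G \<longleftrightarrow> (\<exists>P lt. finite P \<and> strict_poset P lt \<and> G = cover_graph P lt)"

text \<open>
  The library's notion of cycle is the directed one, so in a symmetric digraph traversing a single
  edge back and forth counts as a cycle of length 2. The bound on the length removes exactly these
  degenerate cycles from a simple graph. The infimum of the empty set is \<open>\<infinity>\<close>.
\<close>

definition girth :: "'a pair_pre_digraph \<Rightarrow> enat" where
  "girth G = (INF p \<in> {p. pre_digraph.cycle (with_proj G) p \<and> 3 \<le> length p}. enat (length p))"

definition proper_coloring :: "'a pair_pre_digraph \<Rightarrow> nat \<Rightarrow> ('a \<Rightarrow> nat) \<Rightarrow> bool" where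
  "proper_coloring G m c \<longleftrightarrow>
     (\<forall>x \<in> pverts G. c x < m) \<and> (\<forall>(x, y) \<in> parcs G. c x \<noteq> c y)"

text \<open>
  Only meaningful when some proper colouring with finitely many colours exists, which holds for
  every \<^locale>\<open>pair_graph\<close> (see below).
\<close>

definition chromatic_number :: "'a pair_pre_digraph \<Rightarrow> nat" where
  "chromatic_number G = (LEAST m. \<exists>c. proper_coloring G m c)"

lemma is_hasse_diagram_imp_pair_graph:
  assumes "is_hasse_diagram G"
  shows "pair_graph G"
proof -
  from assms obtain P lt where P: "finite P" "strict_poset P lt" "G = cover_graph P lt"
    unfolding is_hasse_diagram_def by blast
  have arcs: "(x, y) \<in> parcs G \<longleftrightarrow> covered_by P lt x y \<or> covered_by P lt y x" for x y
    using P(3) by (simp add: cover_graph_def)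
  have verts: "pverts G = P"
    using P(3) by (simp add: cover_graph_def)
  have sub: "x \<in> P \<and> y \<in> P \<and> x \<noteq> y" if "(x, y) \<in> parcs G" for x y
    using that P(2) unfolding arcs covered_by_def strict_poset_def irreflp_on_def by blast
  have wf: "e \<in> parcs G \<Longrightarrow> fst e \<in> P \<and> snd e \<in> P \<and> fst e \<noteq> snd e" for e
    using sub by (metis prod.collapse)
  have "parcs G \<subseteq> P \<times> P"
    using sub by auto
  then have fin: "finite (parcs G)"
    using P(1) by (meson finite_SigmaI finite_subset)
  have sym: "symmetric (with_proj G)"
    unfolding symmetric_def with_proj_simps sym_def arcs by blast
  show ?thesis
    by unfold_locales (use wf fin sym P(1) verts in simp_all)
qed

lemma (in pair_graph) proper_coloring_chromatic_number:
  "\<exists>c. proper_coloring G (chromatic_number G) c"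
proof -
  obtain f and m :: nat where f: "f ` pverts G = {i. i < m}" "inj_on f (pverts G)"
    using finite_imp_inj_to_nat_seg[OF pair_finite_verts] by blast
  have "f x \<noteq> f y" if xy: "(x, y) \<in> parcs G" for x y
  proof -
    have "x \<noteq> y"
      using pair_no_loops[OF xy] by simp
    then show ?thesis
      by (metis inj_onD[OF f(2) _ in_arcsD1[OF xy] in_arcsD2[OF xy]])
  qed
  moreover have "f x < m" if "x \<in> pverts G" for x
    using f(1) that by blast
  ultimately have "proper_coloring G m f"
    unfolding proper_coloring_def by blast
  then show ?thesis
    unfolding chromatic_number_def by (blast intro: LeastI[of "\<lambda>m. \<exists>c. proper_coloring G m c"])
qed

end

(*
  Take triples (x, a, y) with x, a < d and y < d^2, thought of as a point (x, y) with a line of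
  slope a through it, and join (x, a, y) to (x', a', y') if x < x', a < a' and the point (x', y')
  lies on the line of (x, a, y). Slopes increase along directed paths, so a path is a convex chain
  and cannot return to its first line: every subgraph is a Hasse diagram. In an
  independent set, every triple is the leftmost one on its line or the steepest one through its
  point, since otherwise it lies in the middle of an edge; so the set has only O(d^3) of the d^4
  triples. Likewise, in a blow-up by m copies every set of order m d^3 spans of order m^2 d^3 edges.

  Two vertices are joined by O(d^3 m^2) walks of length 3, so an edge lies on O(d^(2k-7) m^(k-3))
  cycles shorter than k. With edge weight w of order (ln n) / m and m of order
  d^(2k-7) (ln n)^(k-2), these cycles have total weight at most 1/2 after removing the edge.
  Let Z(U) be the sum of w^|G| over the subgraphs G of U without short cycles. Adding an edge to U
  then multiplies Z by at least 1 + w/2, so the subgraphs that miss all edges inside a given set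
  of order m d^3 carry too little weight for the union over all such sets to exhaust Z. Hence some
  subgraph without short cycles has independence number O(m d^3) = O(n / d), where
  n ~ m d^4 = d^(2k-3) up to logarithms.
*)

theory Submission
  imports Defs "HOL-Real_Asymp.Real_Asymp"
begin

section \<open>Weighted sums over a down-closed family\<close>

lemma sum_UN_le:
  fixes f :: "'a \<Rightarrow> real"
  assumes "finite I" "\<And>i. i \<in> I \<Longrightarrow> finite (A i)" "\<And>x. 0 \<le> f x"
  shows "sum f (\<Union>i\<in>I. A i) \<le> (\<Sum>i\<in>I. sum f (A i))"
  using assms(1,2)
proof (induction I)
  case (insert i I)
  have "sum f (A i \<union> (\<Union>i\<in>I. A i)) \<le> sum f (A i) + sum f (\<Union>i\<in>I. A i)"
    using insert assms(3) by (simp add: sum_Un sum_nonneg)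
  also have "\<dots> \<le> sum f (A i) + (\<Sum>i\<in>I. sum f (A i))" using insert by simp
  finally show ?case using insert.hyps by simp
qed simp

text \<open>The partition function of the hard-core model with fugacity \<open>w\<close> whose
  configurations are the subsets of \<open>U\<close> satisfying \<open>P\<close>.\<close>

definition hard_core_sum :: "real \<Rightarrow> ('a set \<Rightarrow> bool) \<Rightarrow> 'a set \<Rightarrow> real" where
  "hard_core_sum w P U = (\<Sum>G\<in>{G. G \<subseteq> U \<and> P G}. w ^ card G)"

lemma hard_core_sum_pos:
  assumes "finite U" "0 < w" "P {}"
  shows "0 < hard_core_sum w P U"
  unfolding hard_core_sum_def
  by (rule sum_pos2[of _ "{}"]) (use assms in auto)

text \<open>The configurations using \<open>e\<close> are \<open>insert e G\<close> for those
  \<open>G\<close> that admit \<open>e\<close>. A \<open>G\<close> that does not admit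
  \<open>e\<close> contains an obstruction \<open>K\<close>, and by \<open>small\<close> all such
  \<open>G\<close> together carry at most half of the weight.\<close>

lemma hard_core_sum_insert:
  fixes w :: real
  assumes U: "finite U" "e \<notin> U"
    and w: "0 \<le> w"
    and down: "\<And>G G'. P G \<Longrightarrow> G' \<subseteq> G \<Longrightarrow> P G'"
    and \<K>: "finite \<K>" "\<And>K. K \<in> \<K> \<Longrightarrow> finite K"
    and obstruction: "\<And>G. G \<subseteq> U \<Longrightarrow> P G \<Longrightarrow> \<not> P (insert e G) \<Longrightarrow> \<exists>K\<in>\<K>. K \<subseteq> G"
    and small: "(\<Sum>K\<in>\<K>. w ^ card K) \<le> 1 / 2"
  shows "(1 + w / 2) * hard_core_sum w P U \<le> hard_core_sum w P (insert e U)"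
proof -
  let ?Z = "hard_core_sum w P U"
  let ?V = "{G. G \<subseteq> U \<and> P G}"
  let ?A = "{G. G \<subseteq> U \<and> P (insert e G)}"
  have finV: "finite ?V" "finite ?A" using U by auto
  have finVK: "finite {G\<in>?V. K \<subseteq> G}" for K
    by (rule finite_subset[OF _ finV(1)]) blast
  have fG: "finite G" if "G \<subseteq> U" for G using that U by (meson finite_subset)
  have AV: "?A \<subseteq> ?V" using down by blast
  have split: "{G. G \<subseteq> insert e U \<and> P G} = ?V \<union> insert e ` ?A"
  proof (intro equalityI subsetI)
    fix G assume G: "G \<in> {G. G \<subseteq> insert e U \<and> P G}"
    show "G \<in> ?V \<union> insert e ` ?A"
    proof (cases "e \<in> G")
      case True
      then have "G = insert e (G - {e})" by blast
      moreover have "G - {e} \<in> ?A" using G True by (auto simp: insert_absorb)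
      ultimately show ?thesis by blast
    next
      case False then show ?thesis using G by blast
    qed
  qed auto
  have "hard_core_sum w P (insert e U) = ?Z + (\<Sum>G\<in>insert e ` ?A. w ^ card G)"
    unfolding hard_core_sum_def split
    by (rule sum.union_disjoint) (use finV U in auto)
  also have "(\<Sum>G\<in>insert e ` ?A. w ^ card G) = (\<Sum>G\<in>?A. w ^ card (insert e G))"
    by (rule sum.reindex_cong[where l = "insert e"]) (use U in \<open>auto simp: inj_on_def\<close>)
  also have "\<dots> = w * (\<Sum>G\<in>?A. w ^ card G)"
    unfolding sum_distrib_left
    by (rule sum.cong) (use U fG in \<open>auto simp: card_insert_if\<close>)
  also have "(\<Sum>G\<in>?A. w ^ card G) = ?Z - (\<Sum>G\<in>?V - ?A. w ^ card G)"
    unfolding hard_core_sum_def using sum_diff[OF finV(1) AV, of "\<lambda>G. w ^ card G"]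
      sum.subset_diff[OF AV finV(1), of "\<lambda>G. w ^ card G"] by simp
  finally have eq: "hard_core_sum w P (insert e U) = ?Z + w * (?Z - (\<Sum>G\<in>?V - ?A. w ^ card G))" .
  \<comment> \<open>Removing \<open>K\<close> maps these configurations injectively into the family,
    by \<open>down\<close>, and takes the factor \<open>w ^ card K\<close> out of each
    weight.\<close>
  have part: "(\<Sum>G\<in>{G\<in>?V. K \<subseteq> G}. w ^ card G) \<le> w ^ card K * ?Z" if "K \<in> \<K>" for K
  proof -
    have inj: "inj_on (\<lambda>G. G - K) {G\<in>?V. K \<subseteq> G}" by (auto simp: inj_on_def)
    have "(\<Sum>G\<in>{G\<in>?V. K \<subseteq> G}. w ^ card G)
        = w ^ card K * (\<Sum>G\<in>{G\<in>?V. K \<subseteq> G}. w ^ card (G - K))"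
      unfolding sum_distrib_left
    proof (rule sum.cong[OF refl])
      fix G assume "G \<in> {G\<in>?V. K \<subseteq> G}"
      then have "card G = card K + card (G - K)"
        using fG by (metis (mono_tags, lifting) card_Diff_subset card_mono finite_subset
            le_add_diff_inverse mem_Collect_eq)
      then show "w ^ card G = w ^ card K * w ^ card (G - K)" by (simp add: power_add)
    qed
    also have "(\<Sum>G\<in>{G\<in>?V. K \<subseteq> G}. w ^ card (G - K)) = (\<Sum>G\<in>(\<lambda>G. G - K) ` {G\<in>?V. K \<subseteq> G}. w ^ card G)"
      by (simp only: sum.reindex[OF inj] o_def)
    also have "\<dots> \<le> ?Z"
      unfolding hard_core_sum_def
    proof (rule sum_mono2[OF finV(1)])
      show "(\<lambda>G. G - K) ` {G\<in>?V. K \<subseteq> G} \<subseteq> ?V"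
        by (auto dest: down[OF _ Diff_subset])
    qed (use w in auto)
    finally show ?thesis using w by (simp add: mult_left_mono)
  qed
  have "(\<Sum>G\<in>?V - ?A. w ^ card G) \<le> (\<Sum>G\<in>(\<Union>K\<in>\<K>. {G\<in>?V. K \<subseteq> G}). w ^ card G)"
  proof (rule sum_mono2)
    show "?V - ?A \<subseteq> (\<Union>K\<in>\<K>. {G\<in>?V. K \<subseteq> G})"
      using obstruction by blast
  qed (use finVK w \<K>(1) in \<open>auto simp del: mem_Collect_eq\<close>)
  also have "\<dots> \<le> (\<Sum>K\<in>\<K>. \<Sum>G\<in>{G\<in>?V. K \<subseteq> G}. w ^ card G)"
    by (rule sum_UN_le) (use \<K>(1) finVK w in \<open>auto simp del: mem_Collect_eq\<close>)
  also have "\<dots> \<le> (\<Sum>K\<in>\<K>. w ^ card K * ?Z)" by (intro sum_mono part)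
  also have "\<dots> = (\<Sum>K\<in>\<K>. w ^ card K) * ?Z" by (simp add: sum_distrib_right)
  also have "\<dots> \<le> 1 / 2 * ?Z"
    by (intro mult_right_mono small) (use w in \<open>auto simp: hard_core_sum_def intro!: sum_nonneg\<close>)
  finally have "?Z / 2 \<le> ?Z - (\<Sum>G\<in>?V - ?A. w ^ card G)" by simp
  then have "w * (?Z / 2) \<le> w * (?Z - (\<Sum>G\<in>?V - ?A. w ^ card G))"
    using w by (rule mult_left_mono)
  then show ?thesis unfolding eq by (simp add: algebra_simps)
qed

text \<open>The elements of \<open>B\<close> are put back one at a time, each gaining a factor
  \<open>1 + w / 2\<close>. The obstructions \<open>\<K> e\<close> are chosen for all of
  \<open>E\<close>, so they serve at every stage.\<close>

lemma hard_core_sum_delete: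
  fixes w :: real
  assumes E: "finite E" and w: "0 \<le> w"
    and down: "\<And>G G'. P G \<Longrightarrow> G' \<subseteq> G \<Longrightarrow> P G'"
    and \<K>: "\<And>e. finite (\<K> e)" "\<And>e K. K \<in> \<K> e \<Longrightarrow> finite K"
    and obstruction: "\<And>e G. G \<subseteq> E \<Longrightarrow> e \<in> E \<Longrightarrow> P G \<Longrightarrow> \<not> P (insert e G) \<Longrightarrow> \<exists>K\<in>\<K> e. K \<subseteq> G"
    and small: "\<And>e. e \<in> E \<Longrightarrow> (\<Sum>K\<in>\<K> e. w ^ card K) \<le> 1 / 2"
    and B: "B \<subseteq> E"
  shows "(1 + w / 2) ^ card B * hard_core_sum w P (E - B) \<le> hard_core_sum w P E"
proof -
  have "finite B" using B E finite_subset by blast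
  then show ?thesis using B
  proof (induction B)
    case empty then show ?case by simp
  next
    case (insert e B)
    have ob: "\<exists>K\<in>\<K> e. K \<subseteq> G" if "G \<subseteq> E - insert e B" "P G" "\<not> P (insert e G)" for G
      using obstruction[of G e] that insert.prems by blast
    have "(1 + w / 2) * hard_core_sum w P (E - insert e B)
        \<le> hard_core_sum w P (insert e (E - insert e B))"
      by (rule hard_core_sum_insert[where \<K> = "\<K> e" and P = P])
        (fact w ob \<K>(1) down | use \<K>(2) in fast | use insert.prems E small in simp)+
    moreover have "insert e (E - insert e B) = E - B" using insert by auto
    ultimately have "(1 + w / 2) * hard_core_sum w P (E - insert e B) \<le> hard_core_sum w P (E - B)"
      by simp
    then have "(1 + w / 2) ^ card B * ((1 + w / 2) * hard_core_sum w P (E - insert e B))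
        \<le> (1 + w / 2) ^ card B * hard_core_sum w P (E - B)"
      by (rule mult_left_mono) (use w in simp)
    also have "\<dots> \<le> hard_core_sum w P E" by (rule insert.IH) (use insert.prems in blast)
    finally show ?case
      by (simp only: card_insert_disjoint[OF insert.hyps] power_Suc2 mult.assoc)
  qed
qed

text \<open>A union bound for the hard-core measure on \<open>E\<close>: a configuration misses
  \<open>B i\<close> with probability at most \<open>1 / (1 + w / 2) ^ M\<close>, so
  \<open>few\<close> leaves one that misses no \<open>B i\<close>.\<close>

lemma exists_hitting_subset:
  fixes w :: real
  assumes E: "finite E" and w: "0 < w"
    and down: "\<And>G G'. P G \<Longrightarrow> G' \<subseteq> G \<Longrightarrow> P G'" and empty: "P {}"
    and \<K>: "\<And>e. finite (\<K> e)" "\<And>e K. K \<in> \<K> e \<Longrightarrow> finite K"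
    and obstruction: "\<And>e G. G \<subseteq> E \<Longrightarrow> e \<in> E \<Longrightarrow> P G \<Longrightarrow> \<not> P (insert e G) \<Longrightarrow> \<exists>K\<in>\<K> e. K \<subseteq> G"
    and small: "\<And>e. e \<in> E \<Longrightarrow> (\<Sum>K\<in>\<K> e. w ^ card K) \<le> 1 / 2"
    and \<I>: "finite \<I>" "\<And>i. i \<in> \<I> \<Longrightarrow> B i \<subseteq> E" "\<And>i. i \<in> \<I> \<Longrightarrow> M \<le> card (B i)"
    and few: "real (card \<I>) < (1 + w / 2) ^ M"
  shows "\<exists>G\<subseteq>E. P G \<and> (\<forall>i\<in>\<I>. G \<inter> B i \<noteq> {})"
proof (rule ccontr)
  let ?Z = "hard_core_sum w P"
  assume contra: "\<not> ?thesis"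
  have "?Z E \<le> (\<Sum>G\<in>(\<Union>i\<in>\<I>. {G. G \<subseteq> E - B i \<and> P G}). w ^ card G)"
    unfolding hard_core_sum_def
  proof (rule sum_mono2)
    show "{G. G \<subseteq> E \<and> P G} \<subseteq> (\<Union>i\<in>\<I>. {G. G \<subseteq> E - B i \<and> P G})"
    proof
      fix G assume G: "G \<in> {G. G \<subseteq> E \<and> P G}"
      with contra obtain i where "i \<in> \<I>" "G \<inter> B i = {}" by auto
      with G show "G \<in> (\<Union>i\<in>\<I>. {G. G \<subseteq> E - B i \<and> P G})" by auto
    qed
  qed (use E w \<I>(1) in auto)
  also have "\<dots> \<le> (\<Sum>i\<in>\<I>. ?Z (E - B i))"
    unfolding hard_core_sum_def by (rule sum_UN_le) (use E w \<I>(1) in auto)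
  also have "\<dots> \<le> (\<Sum>i\<in>\<I>. ?Z E / (1 + w / 2) ^ M)"
  proof (rule sum_mono)
    fix i assume i: "i \<in> \<I>"
    have "(1 + w / 2) ^ M * ?Z (E - B i) \<le> (1 + w / 2) ^ card (B i) * ?Z (E - B i)"
    proof (intro mult_right_mono power_increasing)
      show "0 \<le> ?Z (E - B i)"
        using hard_core_sum_pos[of "E - B i" w P] E w empty by simp
    qed (use w \<I>(3)[OF i] in simp_all)
    also have "\<dots> \<le> ?Z E"
      by (rule hard_core_sum_delete[where \<K> = \<K> and P = P])
        (fact E down \<K> obstruction small \<I>(2)[OF i] | use w in simp)+
    finally show "?Z (E - B i) \<le> ?Z E / (1 + w / 2) ^ M"
      using w by (simp add: field_simps)
  qed
  also have "\<dots> = card \<I> / (1 + w / 2) ^ M * ?Z E" by simp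
  also have "\<dots> < 1 * ?Z E"
  proof (intro mult_strict_right_mono hard_core_sum_pos)
    have "0 < (1 + w / 2) ^ M" using w by simp
    then show "card \<I> / (1 + w / 2) ^ M < 1" using few by (simp only: pos_divide_less_eq mult_1)
  qed (fact E w empty)+
  finally show False by simp
qed

section \<open>Short cycles\<close>

definition path_edges :: "'a list \<Rightarrow> 'a set set" where
  "path_edges vs = {{vs ! i, vs ! Suc i} | i. Suc i < length vs}"

text \<open>A cycle is the list of its distinct vertices. The closing edge is kept apart from
  \<open>path_edges\<close> because the argument inserts an edge and studies the paths that it
  closes.\<close>

definition no_short_cycle :: "nat \<Rightarrow> 'a set set \<Rightarrow> bool" where
  "no_short_cycle k G \<longleftrightarrow>
     \<not> (\<exists>vs. distinct vs \<and> 3 \<le> length vs \<and> length vs < k \<and>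
             path_edges vs \<subseteq> G \<and> {last vs, hd vs} \<in> G)"

lemma no_short_cycle_subset: "no_short_cycle k G \<Longrightarrow> G' \<subseteq> G \<Longrightarrow> no_short_cycle k G'"
  unfolding no_short_cycle_def by blast

lemma no_short_cycle_empty: "no_short_cycle k {}"
  unfolding no_short_cycle_def by simp

lemma path_edges_conv_image: "path_edges vs = (\<lambda>i. {vs ! i, vs ! Suc i}) ` {..<length vs - 1}"
  unfolding path_edges_def by (auto simp: less_diff_conv)

lemma finite_path_edges: "finite (path_edges vs)"
  unfolding path_edges_conv_image by simp

lemma card_path_edges:
  assumes "distinct vs"
  shows "card (path_edges vs) = length vs - 1"
proof -
  have "inj_on (\<lambda>i. {vs ! i, vs ! Suc i}) {..<length vs - 1}"
  proof (rule inj_onI)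
    fix i j assume ij: "i \<in> {..<length vs - 1}" "j \<in> {..<length vs - 1}"
      and "{vs ! i, vs ! Suc i} = {vs ! j, vs ! Suc j}"
    then have "vs ! i = vs ! j \<or> (vs ! i = vs ! Suc j \<and> vs ! Suc i = vs ! j)"
      by (metis doubleton_eq_iff)
    then show "i = j" using ij assms by (auto simp: nth_eq_iff_index_eq)
  qed
  then show ?thesis unfolding path_edges_conv_image by (simp add: card_image)
qed

text \<open>The ends sit at positions \<open>0\<close> and \<open>length vs - 1\<close>, which are
  consecutive only in a list of two vertices.\<close>

lemma closing_edge_notin_path_edges:
  assumes "distinct vs" "3 \<le> length vs"
  shows "{last vs, hd vs} \<notin> path_edges vs"
proof
  have hl: "hd vs = vs ! 0" "last vs = vs ! (length vs - 1)"
    using assms(2) hd_conv_nth[of vs] last_conv_nth[of vs] by (cases "vs = []"; simp)+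
  assume "{last vs, hd vs} \<in> path_edges vs"
  then obtain i where i: "Suc i < length vs" "{last vs, hd vs} = {vs ! i, vs ! Suc i}"
    unfolding path_edges_def by blast
  then have "(length vs - 1 = i \<and> 0 = Suc i) \<or> (length vs - 1 = Suc i \<and> 0 = i)"
  proof -
    have inj: "vs ! a = vs ! b \<longleftrightarrow> a = b" if "a < length vs" "b < length vs" for a b
      using nth_eq_iff_index_eq[OF assms(1) that] .
    have "0 < length vs" "length vs - 1 < length vs" "i < length vs" using assms(2) i by auto
    then show ?thesis using i unfolding hl doubleton_eq_iff by (simp add: inj)
  qed
  then show False using i assms by auto
qed

text \<open>Cutting a cycle at another place: the only path edge gained is the old closing edge,
  where \<open>ys\<close> now meets \<open>xs\<close>.\<close>

lemma path_edges_rotate: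
  assumes "vs = xs @ ys" "xs \<noteq> []" "ys \<noteq> []"
  shows "path_edges (ys @ xs) \<subseteq> insert {last vs, hd vs} (path_edges vs)"
proof
  fix e assume "e \<in> path_edges (ys @ xs)"
  then obtain i where i: "Suc i < length ys + length xs" "e = {(ys @ xs) ! i, (ys @ xs) ! Suc i}"
    unfolding path_edges_def by auto
  consider "Suc i < length ys" | "Suc i = length ys" | "length ys \<le> i" by linarith
  then show "e \<in> insert {last vs, hd vs} (path_edges vs)"
  proof cases
    case 1
    have "vs ! (length xs + i) = ys ! i" "vs ! (length xs + Suc i) = ys ! Suc i"
      unfolding assms(1) by (simp_all only: nth_append_length_plus)
    then have "e = {vs ! (length xs + i), vs ! Suc (length xs + i)}"
      using i(2) 1 by (simp add: nth_append)
    moreover have "Suc (length xs + i) < length vs" using 1 assms(1) by simp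
    ultimately show ?thesis unfolding path_edges_def by blast
  next
    case 2
    then have "i = length ys - 1" by simp
    then have "(ys @ xs) ! i = last ys" "(ys @ xs) ! Suc i = hd xs"
      using assms(2,3) 2 by (auto simp: nth_append last_conv_nth hd_conv_nth)
    then have "(ys @ xs) ! i = last vs" "(ys @ xs) ! Suc i = hd vs"
      using assms by simp_all
    then show ?thesis using i(2) by auto
  next
    case 3
    define j where "j = i - length ys"
    have j: "i = length ys + j" "Suc i = length ys + Suc j" using 3 j_def by auto
    have "e = {xs ! j, xs ! Suc j}"
      using i(2) unfolding j(2) unfolding j(1) nth_append_length_plus .
    moreover have "Suc j < length xs" using i(1) j by simp
    ultimately have "e = {vs ! j, vs ! Suc j}" "Suc j < length vs"
      by (auto simp: assms(1) nth_append)
    then show ?thesis unfolding path_edges_def by blast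
  qed
qed

text \<open>A short cycle created by inserting \<open>e\<close> must use \<open>e\<close>. Rotated
  so that \<open>e\<close> closes it, the cycle leaves a path inside \<open>G\<close>; the edge sets
  of such paths are the obstructions in the hard-core sum.\<close>

lemma no_short_cycle_insert_obstruction:
  assumes G: "no_short_cycle k G" "\<not> no_short_cycle k (insert e G)"
  shows "\<exists>vs. distinct vs \<and> 3 \<le> length vs \<and> length vs < k \<and> path_edges vs \<subseteq> G \<and> {last vs, hd vs} = e"
proof -
  obtain vs where vs: "distinct vs" "3 \<le> length vs" "length vs < k"
    "path_edges vs \<subseteq> insert e G" "{last vs, hd vs} \<in> insert e G"
    using G(2) unfolding no_short_cycle_def by blast
  have "\<exists>ws. distinct ws \<and> length ws = length vs \<and> path_edges ws \<subseteq> insert e G \<and> {last ws, hd ws} = e"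
  proof (cases "{last vs, hd vs} = e")
    case True then show ?thesis using vs by blast
  next
    case False
    then have "e \<in> path_edges vs" using vs G(1) unfolding no_short_cycle_def by blast
    then obtain i where i: "Suc i < length vs" "e = {vs ! i, vs ! Suc i}"
      unfolding path_edges_def by blast
    let ?xs = "take (Suc i) vs" and ?ys = "drop (Suc i) vs"
    have ne: "?xs \<noteq> []" "?ys \<noteq> []" using i by auto
    have "path_edges (?ys @ ?xs) \<subseteq> insert {last vs, hd vs} (path_edges vs)"
      by (rule path_edges_rotate) (use ne in auto)
    moreover have "last (?ys @ ?xs) = vs ! i" "hd (?ys @ ?xs) = vs ! Suc i"
      using i ne by (auto simp: take_Suc_conv_app_nth hd_drop_conv_nth)
    moreover have "distinct (?ys @ ?xs)"
      using vs(1) by (metis Int_commute append_take_drop_id distinct_append)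
    moreover have "length (?ys @ ?xs) = length vs" using i by simp
    ultimately show ?thesis using vs i by (intro exI[of _ "?ys @ ?xs"]) auto
  qed
  then obtain ws where ws: "distinct ws" "length ws = length vs" "path_edges ws \<subseteq> insert e G"
    "{last ws, hd ws} = e" by blast
  moreover have "e \<notin> path_edges ws"
    using closing_edge_notin_path_edges[of ws] ws vs by simp
  ultimately show ?thesis using vs by (intro exI[of _ ws]) auto
qed

text \<open>The library's cycles are lists of arcs. Their heads, in order, form a vertex list of the
  same length.\<close>

lemma girth_ge:
  assumes "no_short_cycle k E" and arcs: "\<And>x y. (x, y) \<in> parcs G \<Longrightarrow> {x, y} \<in> E"
  shows "enat k \<le> girth G"
  unfolding girth_def
proof (rule INF_greatest, clarify)
  fix p :: "('a \<times> 'a) list"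
  assume "pre_digraph.cycle (with_proj G) p" and len: "3 \<le> length p"
  then obtain u where aw: "pre_digraph.awalk (with_proj G) u p u"
      and dist: "distinct (tl (pre_digraph.awalk_verts (with_proj G) u p))"
    unfolding pre_digraph.cycle_def by blast
  have sub: "set p \<subseteq> parcs G" and cas: "pre_digraph.cas (with_proj G) u p u"
    using aw unfolding pre_digraph.awalk_def by auto
  let ?vs = "map snd p"
  have vs: "distinct ?vs"
    using dist len by (subst (asm) pre_digraph.awalk_verts_conv'[OF cas]) (auto split: if_splits)
  have casE: "fst (q ! Suc i) = snd (q ! i)"
    if "pre_digraph.cas (with_proj G) u q v" "Suc i < length q" for q :: "('a \<times> 'a) list" and i u v
    using that
  proof (induction q arbitrary: u i)
    case (Cons a q)
    then show ?case
      by (cases i; cases q) (auto simp: pre_digraph.cas.simps)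
  qed simp
  have ends: "fst (hd q) = u \<and> snd (last q) = v"
    if "pre_digraph.cas (with_proj G) u q v" "q \<noteq> []" for q :: "('a \<times> 'a) list" and u v
    using that
  proof (induction q arbitrary: u)
    case (Cons a q)
    then show ?case
      by (cases "q = []") (auto simp: pre_digraph.cas.simps)
  qed simp
  have arcE: "{fst a, snd a} \<in> E" if "a \<in> set p" for a
    using that sub arcs[of "fst a" "snd a"] by auto
  have "path_edges ?vs \<subseteq> E"
  proof
    fix e assume "e \<in> path_edges ?vs"
    then obtain i where i: "Suc i < length p" "e = {snd (p ! i), snd (p ! Suc i)}"
      unfolding path_edges_def by auto
    then show "e \<in> E" using arcE[of "p ! Suc i"] casE[OF cas i(1)] by simp
  qed
  \<comment> \<open>The first arc starts at \<open>u\<close>, which is the head of the last arc, so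
    it is the closing edge of \<open>?vs\<close>.\<close>
  moreover have "{last ?vs, hd ?vs} \<in> E"
    using arcE[of "hd p"] ends[OF cas] len by (cases "p = []") (auto simp: last_map hd_map)
  ultimately have "\<not> length p < k"
    using assms(1) vs len unfolding no_short_cycle_def by (metis length_map)
  then show "enat k \<le> enat (length p)" by simp
qed

section \<open>The incidence graph\<close>

text \<open>Take a counted element with the largest value of \<open>f\<close>. Every counted element
  either lies below it, which fewer than \<open>m\<close> do, or shares its value, which at most
  \<open>m\<close> do.\<close>

lemma card_few_smaller_le:
  fixes f :: "'a \<Rightarrow> int"
  assumes S: "finite S" and level: "\<And>c. card {v\<in>S. f v = c} \<le> m"
  shows "card {u\<in>S. card {v\<in>S. f v < f u} < m} \<le> 2 * m"
proof -
  define B where "B = {u\<in>S. card {v\<in>S. f v < f u} < m}"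
  show ?thesis
  proof (cases "B = {}")
    case True
    then show ?thesis unfolding B_def[symmetric] by simp
  next
    case False
    have finB: "finite B" unfolding B_def using S by simp
    have "Max (f ` B) \<in> f ` B" by (rule Max_in) (use finB False in auto)
    then obtain u where u: "u \<in> B" "f u = Max (f ` B)" by auto
    have "B \<subseteq> {v\<in>S. f v < f u} \<union> {v\<in>S. f v = f u}"
    proof
      fix v assume "v \<in> B"
      then have "f v \<le> f u" "v \<in> S" using finB u(2) unfolding B_def by auto
      then show "v \<in> {v\<in>S. f v < f u} \<union> {v\<in>S. f v = f u}" by auto
    qed
    then have "card B \<le> card ({v\<in>S. f v < f u} \<union> {v\<in>S. f v = f u})"
      by (rule card_mono[rotated]) (use S in simp)
    also have "\<dots> \<le> card {v\<in>S. f v < f u} + card {v\<in>S. f v = f u}" by (rule card_Un_le)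
    also have "\<dots> \<le> m + m"
      by (rule add_mono[OF _ level]) (use u(1) in \<open>simp add: B_def\<close>)
    finally show ?thesis unfolding B_def[symmetric] by simp
  qed
qed

text \<open>Used with lines as keys and \<open>f = X\<close>, and with points as keys and
  \<open>f = - A\<close>: few vertices lack \<open>m\<close> others to their left on their line, or
  \<open>m\<close> steeper ones at their point.\<close>

lemma card_few_smaller_in_class_le:
  fixes f :: "'a \<Rightarrow> int"
  assumes I: "finite I" and keys: "finite \<K>" "key ` I \<subseteq> \<K>"
    and level: "\<And>\<kappa> c. card {v\<in>I. key v = \<kappa> \<and> f v = c} \<le> m"
  shows "card {u\<in>I. card {v\<in>I. key v = key u \<and> f v < f u} < m} \<le> card \<K> * (2 * m)"
proof -
  define S where "S \<kappa> = {v\<in>I. key v = \<kappa>}" for \<kappa>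
  define B where "B \<kappa> = {u\<in>S \<kappa>. card {v\<in>S \<kappa>. f v < f u} < m}" for \<kappa>
  have S_f: "{v\<in>S \<kappa>. Q v} = {v\<in>I. key v = \<kappa> \<and> Q v}" for \<kappa> Q unfolding S_def by auto
  have "{u\<in>I. card {v\<in>I. key v = key u \<and> f v < f u} < m} \<subseteq> (\<Union>\<kappa>\<in>\<K>. B \<kappa>)"
  proof
    fix u assume "u \<in> {u\<in>I. card {v\<in>I. key v = key u \<and> f v < f u} < m}"
    then have "u \<in> B (key u)" "key u \<in> \<K>" using keys(2) unfolding B_def S_f by auto
    then show "u \<in> (\<Union>\<kappa>\<in>\<K>. B \<kappa>)" by blast
  qed
  then have "card {u\<in>I. card {v\<in>I. key v = key u \<and> f v < f u} < m} \<le> card (\<Union>\<kappa>\<in>\<K>. B \<kappa>)"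
    by (rule card_mono[rotated]) (use keys(1) I in \<open>simp add: B_def S_def\<close>)
  also have "\<dots> \<le> (\<Sum>\<kappa>\<in>\<K>. card (B \<kappa>))" by (rule card_UN_le[OF keys(1)])
  also have "\<dots> \<le> (\<Sum>\<kappa>\<in>\<K>. 2 * m)"
    unfolding B_def
    by (intro sum_mono card_few_smaller_le) (simp_all only: S_f level, simp add: S_def I)
  finally show ?thesis by simp
qed

section \<open>Coordinates and adjacency in the blown-up incidence graph\<close>

locale incidence_host =
  fixes d m n :: nat
  assumes d_pos: "0 < d" and n_le: "n \<le> m * d ^ 4"
begin

text \<open>A vertex number encodes the triple \<open>(X, A, Y)\<close> and the index of its copy in the blow-up.\<close>

definition X :: "nat \<Rightarrow> int" where "X v = int (v mod d)"
definition A :: "nat \<Rightarrow> int" where "A v = int (v div d mod d)"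
definition Y :: "nat \<Rightarrow> int" where "Y v = int (v div d\<^sup>2 mod d\<^sup>2)"
definition copy :: "nat \<Rightarrow> nat" where "copy v = v div d ^ 4"

text \<open>The slope of the left vertex of an edge is the smaller one; using the minimum makes \<open>adj\<close> symmetric.\<close>

definition adj :: "nat \<Rightarrow> nat \<Rightarrow> bool" where
  "adj u v \<longleftrightarrow> X u \<noteq> X v \<and> A u \<noteq> A v \<and> (X u < X v \<longleftrightarrow> A u < A v) \<and>
     Y v - Y u = min (A u) (A v) * (X v - X u)"

lemma coords_inject:
  assumes "X u = X v" "A u = A v" "Y u = Y v" "copy u = copy v"
  shows "u = v"
proof -
  \<comment> \<open>Mixed-radix expansion: the digits of \<open>w\<close>, from the lowest, have
    bases \<open>d\<close>, \<open>d\<close> and \<open>d\<^sup>2\<close>, and \<open>copy w\<close>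
    is the remaining leading part.\<close>
  have dec: "w = ((copy w * d\<^sup>2 + w div d\<^sup>2 mod d\<^sup>2) * d + w div d mod d) * d + w mod d" for w
  proof -
    have "w div d\<^sup>2 = copy w * d\<^sup>2 + w div d\<^sup>2 mod d\<^sup>2"
      unfolding copy_def by (metis div_mult2_eq div_mult_mod_eq numeral_Bit0 power_add)
    moreover have "w div d = w div d\<^sup>2 * d + w div d mod d"
      by (metis div_mult2_eq div_mult_mod_eq power2_eq_square)
    moreover have "w = w div d * d + w mod d" by simp
    ultimately show ?thesis by metis
  qed
  show ?thesis
    using assms dec[of u] dec[of v] unfolding X_def A_def Y_def by simp
qed

lemma coord_bounds: "X v \<in> {0..<int d}" "A v \<in> {0..<int d}" "Y v \<in> {0..<int (d\<^sup>2)}"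
  unfolding X_def A_def Y_def using d_pos by (simp_all add: nat_int_comparison(2)[symmetric] del: of_nat_power)

lemma copy_less: "v < n \<Longrightarrow> copy v < m"
  unfolding copy_def using n_le d_pos by (simp add: div_less_iff_less_mult)

lemma adj_sym: "adj u v \<Longrightarrow> adj v u"
  unfolding adj_def by (auto simp: min.commute algebra_simps)

lemma no_triangle: "adj u v \<Longrightarrow> adj v w \<Longrightarrow> adj w u \<Longrightarrow> False"
proof -
  \<comment> \<open>Both edges at the leftmost vertex \<open>u\<close> follow its line, so
    \<open>v\<close> and \<open>w\<close> lie on it. The edge between them would then have slope
    \<open>A u\<close> as well as \<open>A v\<close>.\<close>
  have mono: False if "adj u v" "adj v w" "adj u w" "X u < X v" "X v < X w" for u v w
  proof -
    have "Y v - Y u = A u * (X v - X u)" "Y w - Y v = A v * (X w - X v)" "Y w - Y u = A u * (X w - X u)"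
      using that unfolding adj_def by (simp_all add: min_def)
    then have "(A v - A u) * (X w - X v) = 0"
      unfolding left_diff_distrib right_diff_distrib by linarith
    moreover have "A u \<noteq> A v" "X v \<noteq> X w" using that unfolding adj_def by auto
    ultimately show False by simp
  qed
  assume a: "adj u v" "adj v w" "adj w u"
  note s = a[THEN adj_sym]
  have "X u \<noteq> X v" "X v \<noteq> X w" "X w \<noteq> X u" using a unfolding adj_def by auto
  then consider "X u < X v" "X v < X w" | "X u < X w" "X w < X v" | "X v < X u" "X u < X w"
    | "X v < X w" "X w < X u" | "X w < X u" "X u < X v" | "X w < X v" "X v < X u" by linarith
  then show False
    by cases (fact mono[OF a(1) a(2) s(3)] mono[OF s(3) s(2) a(1)] mono[OF s(1) s(3) a(2)]
        mono[OF a(2) a(3) s(1)] mono[OF a(3) a(1) s(2)] mono[OF s(2) s(1) a(3)])+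
qed

section \<open>Counting copies, neighbours and walks\<close>

lemma card_same_coords_le:
  assumes "S \<subseteq> {..<n}"
    and "\<And>u v. u \<in> S \<Longrightarrow> v \<in> S \<Longrightarrow> X u = X v \<and> A u = A v \<and> Y u = Y v"
  shows "card S \<le> m"
proof -
  have "inj_on copy S"
  proof (rule inj_onI)
    fix u v assume "u \<in> S" "v \<in> S" "copy u = copy v"
    then show "u = v" using coords_inject[of u v] assms(2)[of u v] by simp
  qed
  moreover have "copy ` S \<subseteq> {..<m}" using assms(1) copy_less by auto
  ultimately have "card S \<le> card {..<m}" by (rule card_inj_on_le) simp
  then show ?thesis by simp
qed

text \<open>Given \<open>u\<close>, the values \<open>X v\<close> and \<open>A v\<close> force
  \<open>Y v\<close>, leaving \<open>d\<^sup>2\<close> triples with at most \<open>m\<close> copies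
  each.\<close>

lemma card_neighbours_le: "card {v. v < n \<and> adj u v} \<le> d\<^sup>2 * m"
proof -
  let ?f = "\<lambda>v. (X v, A v, copy v)" and ?R = "{0..<int d} \<times> {0..<int d} \<times> {..<m}"
  have "inj_on ?f {v. v < n \<and> adj u v}"
  proof (rule inj_onI)
    fix v w assume "v \<in> {v. v < n \<and> adj u v}" "w \<in> {v. v < n \<and> adj u v}" "?f v = ?f w"
    then have vw: "adj u v" "adj u w" "X v = X w" "A v = A w" "copy v = copy w" by auto
    then have "Y v - Y u = Y w - Y u" unfolding adj_def by simp
    then show "v = w" using vw coords_inject by simp
  qed
  moreover have "?f ` {v. v < n \<and> adj u v} \<subseteq> ?R"
    using coord_bounds copy_less by auto
  ultimately have "card {v. v < n \<and> adj u v} \<le> card ?R"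
    by (rule card_inj_on_le) auto
  then show ?thesis by (simp add: power2_eq_square)
qed

text \<open>\<open>Y p\<close> is forced from \<open>u\<close> and \<open>Y q\<close> from
  \<open>v\<close>, which leaves four coordinates of size \<open>d\<close>; the middle edge adds the
  linear equation \<open>close\<close>. It determines \<open>X p\<close> or \<open>X q\<close>
  unless all three slopes agree, and then \<open>A q = A u\<close> or \<open>A p = A v\<close>. So
  one coordinate always drops out, in one of four ways.\<close>

lemma card_two_step_le: "card {(p, q). p < n \<and> q < n \<and> adj u p \<and> adj p q \<and> adj q v} \<le> 4 * (d ^ 3 * m\<^sup>2)"
proof -
  let ?W = "{(p, q). p < n \<and> q < n \<and> adj u p \<and> adj p q \<and> adj q v}"
  let ?R = "({0..<int d} \<times> {0..<int d} \<times> {0..<int d}) \<times> {..<m} \<times> {..<m}"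
  define \<alpha> where "\<alpha> p q = min (A p) (A q)" for p q
  have finW: "finite ?W" by (rule finite_subset[of _ "{..<n} \<times> {..<n}"]) auto
  have Yp: "Y p = Y u + \<alpha> u p * (X p - X u)" and Yq: "Y q = Y v - \<alpha> q v * (X v - X q)"
    and Ypq: "Y q - Y p = \<alpha> p q * (X q - X p)" if "(p, q) \<in> ?W" for p q
    using that unfolding adj_def \<alpha>_def by auto
  have close: "(\<alpha> u p - \<alpha> p q) * X p + (\<alpha> p q - \<alpha> q v) * X q = Y v - Y u + \<alpha> u p * X u - \<alpha> q v * X v"
    if "(p, q) \<in> ?W" for p q
    using Yp[OF that] Yq[OF that] Ypq[OF that] by (simp add: algebra_simps)
  have eq: "p = p' \<and> q = q'"
    if "(p, q) \<in> ?W" "(p', q') \<in> ?W" "X p = X p'" "A p = A p'" "X q = X q'" "A q = A q'"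
      "copy p = copy p'" "copy q = copy q'" for p q p' q'
  proof -
    have "\<alpha> u p = \<alpha> u p'" "\<alpha> q v = \<alpha> q' v" unfolding \<alpha>_def using that by simp_all
    then have "Y p = Y p'" "Y q = Y q'"
      unfolding Yp[OF that(1)] Yp[OF that(2)] Yq[OF that(1)] Yq[OF that(2)] using that(3,5) by simp_all
    then show ?thesis using that(3-) coords_inject by blast
  qed
  \<comment> \<open>In each case \<open>f\<close> lists the three coordinates that stay free;
    \<open>inj\<close> says that they determine the fourth.\<close>
  have bnd: "card S \<le> d ^ 3 * m\<^sup>2"
    if S: "S \<subseteq> ?W" and f: "f \<in> {\<lambda>p q. (A p, X q, A q), \<lambda>p q. (X p, A p, X q), \<lambda>p q. (X p, A p, A q), \<lambda>p q. (X p, X q, A q)}"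
      and inj: "\<And>p q p' q'. (p, q) \<in> S \<Longrightarrow> (p', q') \<in> S \<Longrightarrow> f p q = f p' q' \<Longrightarrow>
        X p = X p' \<and> A p = A p' \<and> X q = X q' \<and> A q = A q'"
    for S and f :: "nat \<Rightarrow> nat \<Rightarrow> int \<times> int \<times> int"
  proof -
    let ?g = "\<lambda>(p, q). (f p q, copy p, copy q)"
    have "inj_on ?g S"
    proof (rule inj_onI, clarify)
      fix p q p' q'
      assume a: "(p, q) \<in> S" "(p', q') \<in> S" "f p q = f p' q'" "copy p = copy p'" "copy q = copy q'"
      then show "p = p' \<and> q = q'"
        using inj[OF a(1-3)] eq[OF subsetD[OF S a(1)] subsetD[OF S a(2)]] by blast
    qed
    moreover have "?g ` S \<subseteq> ?R"
    proof (rule image_subsetI)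
      fix z assume "z \<in> S"
      moreover obtain p q where z: "z = (p, q)" by (cases z)
      ultimately have "copy p < m" "copy q < m" using S copy_less by auto
      moreover have "f p q \<in> {0..<int d} \<times> {0..<int d} \<times> {0..<int d}"
        using f coord_bounds(1,2)[of p] coord_bounds(1,2)[of q] by fastforce
      ultimately show "?g z \<in> ?R" unfolding z by simp
    qed
    ultimately have "card S \<le> card ?R" by (rule card_inj_on_le) auto
    then show ?thesis by (simp add: power2_eq_square power3_eq_cube mult.assoc)
  qed
  define S1 where "S1 = {(p, q)\<in>?W. \<alpha> u p \<noteq> \<alpha> p q}"
  define S2 where "S2 = {(p, q)\<in>?W. A q = A u}"
  define S3 where "S3 = {(p, q)\<in>?W. \<alpha> p q \<noteq> \<alpha> q v}"
  define S4 where "S4 = {(p, q)\<in>?W. A p = A v}"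
  have "card S1 \<le> d ^ 3 * m\<^sup>2"
  proof (rule bnd[where f = "\<lambda>p q. (A p, X q, A q)"])
    fix p q p' q' assume a: "(p, q) \<in> S1" "(p', q') \<in> S1" "(A p, X q, A q) = (A p', X q', A q')"
    then have al: "\<alpha> u p = \<alpha> u p'" "\<alpha> p q = \<alpha> p' q'" "\<alpha> q v = \<alpha> q' v" unfolding \<alpha>_def by auto
    have W: "(p, q) \<in> ?W" "(p', q') \<in> ?W" and ne: "\<alpha> u p - \<alpha> p q \<noteq> 0" and same: "X q = X q'"
      using a unfolding S1_def by auto
    have "(\<alpha> u p - \<alpha> p q) * X p = (\<alpha> u p - \<alpha> p q) * X p'"
      using close[OF W(1)] close[OF W(2)] unfolding al[symmetric] same[symmetric] by linarith
    then have "X p = X p'" using ne by simp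
    then show "X p = X p' \<and> A p = A p' \<and> X q = X q' \<and> A q = A q'"
      using a(3) by simp
  qed (auto simp: S1_def)
  moreover have "card S2 \<le> d ^ 3 * m\<^sup>2"
    by (rule bnd[where f = "\<lambda>p q. (X p, A p, X q)"]) (auto simp: S2_def)
  moreover have "card S3 \<le> d ^ 3 * m\<^sup>2"
  proof (rule bnd[where f = "\<lambda>p q. (X p, A p, A q)"])
    fix p q p' q' assume a: "(p, q) \<in> S3" "(p', q') \<in> S3" "(X p, A p, A q) = (X p', A p', A q')"
    then have al: "\<alpha> u p = \<alpha> u p'" "\<alpha> p q = \<alpha> p' q'" "\<alpha> q v = \<alpha> q' v" unfolding \<alpha>_def by auto
    have W: "(p, q) \<in> ?W" "(p', q') \<in> ?W" and ne: "\<alpha> p q - \<alpha> q v \<noteq> 0" and same: "X p = X p'"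
      using a unfolding S3_def by auto
    have "(\<alpha> p q - \<alpha> q v) * X q = (\<alpha> p q - \<alpha> q v) * X q'"
      using close[OF W(1)] close[OF W(2)] unfolding al[symmetric] same[symmetric] by linarith
    then have "X q = X q'" using ne by simp
    then show "X p = X p' \<and> A p = A p' \<and> X q = X q' \<and> A q = A q'"
      using a(3) by simp
  qed (auto simp: S3_def)
  moreover have "card S4 \<le> d ^ 3 * m\<^sup>2"
    by (rule bnd[where f = "\<lambda>p q. (X p, X q, A q)"]) (auto simp: S4_def)
  moreover have "?W \<subseteq> S1 \<union> S2 \<union> (S3 \<union> S4)"
  proof
    fix z assume z: "z \<in> ?W"
    obtain p q where pq: "z = (p, q)" by (cases z)
    \<comment> \<open>If the slopes agree, the common value is \<open>A p\<close> or
      \<open>A q\<close>. If it is \<open>A p\<close>, the edge from \<open>q\<close> to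
      \<open>v\<close> can only take it from \<open>v\<close>, so \<open>A p = A v\<close>;
      symmetrically, the other case gives \<open>A q = A u\<close>.\<close>
    have "A u \<noteq> A p" "A p \<noteq> A q" "A q \<noteq> A v" using z pq unfolding adj_def by auto
    then have "\<alpha> u p \<noteq> \<alpha> p q \<or> A q = A u \<or> \<alpha> p q \<noteq> \<alpha> q v \<or> A p = A v"
      unfolding \<alpha>_def min_def by (auto split: if_splits)
    then show "z \<in> S1 \<union> S2 \<union> (S3 \<union> S4)"
      using z unfolding S1_def S2_def S3_def S4_def pq by auto
  qed
  then have "card ?W \<le> card (S1 \<union> S2 \<union> (S3 \<union> S4))"
    by (intro card_mono) (auto simp: S1_def S2_def S3_def S4_def intro: finite_subset[OF _ finW])
  moreover have "card (S1 \<union> S2 \<union> (S3 \<union> S4)) \<le> (card S1 + card S2) + (card S3 + card S4)"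
    by (meson add_mono card_Un_le le_trans)
  ultimately show ?thesis by linarith
qed

definition walks :: "nat \<Rightarrow> nat \<Rightarrow> nat \<Rightarrow> nat list set" where
  "walks l u v = {ws. length ws = l \<and> set ws \<subseteq> {..<n} \<and> successively adj ws \<and> hd ws = u \<and> last ws = v}"

lemma finite_walks: "finite (walks l u v)"
  by (rule finite_subset[OF _ finite_lists_length_eq[of "{..<n}" l]]) (auto simp: walks_def)

text \<open>\<open>r + 4\<close> counts vertices, so there are \<open>r + 3\<close> edges:
  \<open>r\<close> free choices of a neighbour, then three steps with both ends fixed.\<close>

lemma card_walks_le: "card (walks (r + 4) u v) \<le> (d\<^sup>2 * m) ^ r * (4 * (d ^ 3 * m\<^sup>2))"
proof (induction r arbitrary: u)
  case 0
  let ?W = "{(p, q). p < n \<and> q < n \<and> adj u p \<and> adj p q \<and> adj q v}"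
  have "walks 4 u v \<subseteq> (\<lambda>(p, q). [u, p, q, v]) ` ?W"
  proof
    fix ws assume ws: "ws \<in> walks 4 u v"
    then obtain a b c e where "ws = [a, b, c, e]"
      unfolding walks_def by (auto simp: numeral_eq_Suc length_Suc_conv)
    then show "ws \<in> (\<lambda>(p, q). [u, p, q, v]) ` ?W"
      using ws unfolding walks_def by (auto simp: image_iff)
  qed
  moreover have "finite ?W" by (rule finite_subset[of _ "{..<n} \<times> {..<n}"]) auto
  ultimately have "card (walks 4 u v) \<le> card ?W" by (rule surj_card_le[rotated])
  then show ?case using card_two_step_le[of u v] by simp
next
  case (Suc r)
  let ?N = "{z. z < n \<and> adj u z}"
  have "walks (Suc r + 4) u v \<subseteq> (\<Union>z\<in>?N. (#) u ` walks (r + 4) z v)"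
  proof
    fix ws assume ws: "ws \<in> walks (Suc r + 4) u v"
    then obtain a b zs where "ws = a # b # zs"
      unfolding walks_def by (auto simp: numeral_eq_Suc length_Suc_conv)
    then have "a = u" "b \<in> ?N" "b # zs \<in> walks (r + 4) b v"
      using ws unfolding walks_def by auto
    then show "ws \<in> (\<Union>z\<in>?N. (#) u ` walks (r + 4) z v)" using \<open>ws = a # b # zs\<close> by blast
  qed
  then have "card (walks (Suc r + 4) u v) \<le> card (\<Union>z\<in>?N. (#) u ` walks (r + 4) z v)"
    by (intro card_mono) (auto simp: finite_walks)
  also have "\<dots> \<le> (\<Sum>z\<in>?N. card ((#) u ` walks (r + 4) z v))" by (rule card_UN_le) simp
  also have "\<dots> \<le> (\<Sum>z\<in>?N. (d\<^sup>2 * m) ^ r * (4 * (d ^ 3 * m\<^sup>2)))"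
    by (intro sum_mono order_trans[OF card_image_le[OF finite_walks] Suc.IH])
  also have "\<dots> \<le> (d\<^sup>2 * m) * ((d\<^sup>2 * m) ^ r * (4 * (d ^ 3 * m\<^sup>2)))"
    unfolding sum_constant of_nat_id by (rule mult_le_mono1[OF card_neighbours_le])
  finally show ?case by (simp only: power_Suc mult.assoc)
qed

lemma walks_3_empty:
  assumes "adj u v"
  shows "walks 3 u v = {}"
proof (rule equals0I)
  fix ws assume ws: "ws \<in> walks 3 u v"
  then obtain a b c where "ws = [a, b, c]"
    unfolding walks_def by (auto simp: numeral_eq_Suc length_Suc_conv)
  then have "adj u b" "adj b v" using ws unfolding walks_def by auto
  then show False using no_triangle adj_sym assms by blast
qed

section \<open>Supersaturation: many edges inside every large vertex set\<close>

definition edges :: "nat set set" where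
  "edges = {{u, v} | u v. u < n \<and> v < n \<and> adj u v}"

lemma finite_edges: "finite edges"
  by (rule finite_subset[of _ "Pow {..<n}"]) (auto simp: edges_def)

text \<open>Call \<open>u\<close> good if \<open>I\<close> has at least \<open>m\<close> vertices to
  its left on its line and at least \<open>m\<close> steeper ones at its point. Any \<open>v\<close>
  of the first kind is adjacent to any \<open>w\<close> of the second. At least half of the required
  \<open>12 * m * d ^ 3\<close> vertices are good, and the triples \<open>(u, v, w)\<close> are
  counted twice.\<close>

lemma card_edges_within_ge:
  assumes I: "I \<subseteq> {..<n}" and card: "12 * m * d ^ 3 \<le> card I" and m: "0 < m"
  shows "6 * m\<^sup>2 * d ^ 3 \<le> card {e\<in>edges. e \<subseteq> I}"
proof -
  have finI: "finite I" using I finite_subset by blast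
  let ?line = "\<lambda>v. (A v, Y v - A v * X v)" and ?point = "\<lambda>v. (X v, Y v)"
  let ?left = "\<lambda>u. {v\<in>I. ?line v = ?line u \<and> X v < X u}"
  let ?up = "\<lambda>u. {v\<in>I. ?point v = ?point u \<and> - A v < - A u}"
  let ?lines = "{0..<int d} \<times> {- int (d\<^sup>2)..<int (d\<^sup>2)}" and ?points = "{0..<int d} \<times> {0..<int (d\<^sup>2)}"
  have "?line ` I \<subseteq> ?lines"
  proof (rule image_subsetI)
    fix v
    have "0 \<le> A v * X v" "A v * X v \<le> int d * int d"
      using coord_bounds[of v] by (auto intro!: mult_mono)
    moreover have "0 \<le> Y v" "Y v < int (d\<^sup>2)" "A v \<in> {0..<int d}" using coord_bounds[of v] by auto
    moreover have "int (d\<^sup>2) = int d * int d" by (simp add: power2_eq_square)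
    ultimately show "(A v, Y v - A v * X v) \<in> ?lines"
      unfolding mem_Times_iff atLeastLessThan_iff fst_conv snd_conv by linarith
  qed
  then have b1: "card {u\<in>I. card (?left u) < m} \<le> card ?lines * (2 * m)"
    by (intro card_few_smaller_in_class_le finI)
      (auto intro!: card_same_coords_le dest: subsetD[OF I])
  have "?point ` I \<subseteq> ?points" using coord_bounds by auto
  then have b2: "card {u\<in>I. card (?up u) < m} \<le> card ?points * (2 * m)"
    by (intro card_few_smaller_in_class_le finI)
      (auto intro!: card_same_coords_le dest: subsetD[OF I])
  define good where "good = {u\<in>I. m \<le> card (?left u) \<and> m \<le> card (?up u)}"
  have fing: "finite good" unfolding good_def using finI by simp
  have "I \<subseteq> good \<union> ({u\<in>I. card (?left u) < m} \<union> {u\<in>I. card (?up u) < m})"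
    unfolding good_def by auto
  then have "card I \<le> card (good \<union> ({u\<in>I. card (?left u) < m} \<union> {u\<in>I. card (?up u) < m}))"
    using finI fing by (intro card_mono) auto
  also have "\<dots> \<le> card good + (card {u\<in>I. card (?left u) < m} + card {u\<in>I. card (?up u) < m})"
    by (meson add_left_mono card_Un_le le_trans)
  also have "\<dots> \<le> card good + (card ?lines * (2 * m) + card ?points * (2 * m))"
    using b1 b2 by linarith
  \<comment> \<open>There are \<open>2 * d ^ 3\<close> possible lines and \<open>d ^ 3\<close>
    points.\<close>
  also have "card ?lines * (2 * m) + card ?points * (2 * m) = 6 * m * d ^ 3"
    by (simp add: power2_eq_square power3_eq_cube nat_mult_distrib)
  finally have good: "6 * m * d ^ 3 \<le> card good" using card by linarith
  define P where "P = {(v, w). v \<in> I \<and> w \<in> I \<and> adj v w \<and> X v < X w}"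
  have finP: "finite P" by (rule finite_subset[of _ "I \<times> I"]) (auto simp: P_def finI)
  let ?F = "\<lambda>p. {u\<in>good. p \<in> ?left u \<times> ?up u}"
  \<comment> \<open>\<open>v\<close> has the same line as \<open>u\<close>, and \<open>w\<close> the
    same point; so the line of \<open>v\<close> passes through the point of \<open>w\<close>, and
    \<open>A v = A u < A w\<close>.\<close>
  have inP: "(v, w) \<in> P" if "v \<in> ?left u" "w \<in> ?up u" for u v w
    using that unfolding P_def adj_def by (auto simp: algebra_simps min_def)
  have "card good * m\<^sup>2 \<le> (\<Sum>u\<in>good. card (?left u \<times> ?up u))"
    using sum_bounded_below[of good "m\<^sup>2" "\<lambda>u. card (?left u \<times> ?up u)"]
    by (auto simp: good_def card_cartesian_product power2_eq_square mult_le_mono)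
  also have "\<dots> = card (SIGMA u:good. ?left u \<times> ?up u)"
    using fing finI by (intro card_SigmaI[symmetric]) auto
  also have "\<dots> = card ((\<lambda>(u, p). (p, u)) ` (SIGMA u:good. ?left u \<times> ?up u))"
    by (rule card_image[symmetric]) (auto simp: inj_on_def)
  also have "\<dots> \<le> card (SIGMA p:P. ?F p)"
    by (rule card_mono) (use finP fing inP in \<open>auto\<close>)
  also have "\<dots> = (\<Sum>p\<in>P. card (?F p))"
    using finP fing by (intro card_SigmaI) auto
  \<comment> \<open>The pair \<open>(v, w)\<close> fixes the middle vertex \<open>u\<close> up to
    its copy: the slope comes from \<open>v\<close>, the point from \<open>w\<close>.\<close>
  also have "\<dots> \<le> (\<Sum>p\<in>P. m)"
    by (intro sum_mono card_same_coords_le) (use I in \<open>auto simp: good_def\<close>)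
  finally have "card good * m * m \<le> card P * m" by (simp add: power2_eq_square mult.assoc)
  then have "card good * m \<le> card P" using m by simp
  with mult_le_mono1[OF good, of m] have "6 * m * d ^ 3 * m \<le> card P" by linarith
  moreover have "card P = card ((\<lambda>(v, w). {v, w}) ` P)"
    by (rule card_image[symmetric]) (auto simp: inj_on_def P_def doubleton_eq_iff)
  moreover have "card ((\<lambda>(v, w). {v, w}) ` P) \<le> card {e\<in>edges. e \<subseteq> I}"
  proof (rule card_mono)
    show "finite {e\<in>edges. e \<subseteq> I}" using finite_edges by simp
  qed (use I in \<open>auto simp: P_def edges_def\<close>)
  ultimately show ?thesis by (simp add: power2_eq_square ac_simps)
qed

end

section \<open>Subgraphs of the incidence graph are Hasse diagrams\<close>

text \<open>A colour class with more than \<open>s\<close> vertices would contain \<open>s\<close>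
  vertices spanning an edge.\<close>

lemma card_vertices_le_colors_mult:
  assumes col: "proper_coloring G M c" and verts: "pverts G = V" "finite V"
    and dense: "\<And>I. I \<subseteq> V \<Longrightarrow> card I = s \<Longrightarrow> \<exists>(x, y)\<in>parcs G. x \<in> I \<and> y \<in> I"
  shows "card V \<le> M * s"
proof -
  let ?C = "\<lambda>i. {x\<in>V. c x = i}"
  have small: "card (?C i) \<le> s" for i
  proof (rule ccontr)
    assume "\<not> card (?C i) \<le> s"
    then obtain I where I: "I \<subseteq> ?C i" "card I = s"
      using obtain_subset_with_card_n[of s "?C i"] by auto
    then obtain x y where "(x, y) \<in> parcs G" "x \<in> ?C i" "y \<in> ?C i"
      using dense[of I] by blast
    then show False using col unfolding proper_coloring_def by auto
  qed
  have "V \<subseteq> (\<Union>i<M. ?C i)" using col verts unfolding proper_coloring_def by auto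
  then have "card V \<le> card (\<Union>i<M. ?C i)" by (rule card_mono[rotated]) (use verts in simp)
  also have "\<dots> \<le> (\<Sum>i<M. card (?C i))" by (rule card_UN_le) simp
  also have "\<dots> \<le> (\<Sum>i<M. s)" by (intro sum_mono small)
  finally show ?thesis by simp
qed

context incidence_host
begin

lemma edge_iff: "{u, v} \<in> edges \<longleftrightarrow> u < n \<and> v < n \<and> adj u v"
  unfolding edges_def using adj_sym by (auto simp: doubleton_eq_iff)

definition arc :: "nat set set \<Rightarrow> nat \<Rightarrow> nat \<Rightarrow> bool" where
  "arc G u v \<longleftrightarrow> {u, v} \<in> G \<and> X u < X v"

lemma arcD:
  assumes "G \<subseteq> edges" "arc G u v"
  shows "u < n" "v < n" "X u < X v" "A u < A v" "Y v - Y u = A u * (X v - X u)"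
proof -
  have uv: "u < n" "v < n" "adj u v" "X u < X v"
    using assms edge_iff[of u v] unfolding arc_def by auto
  then show "u < n" "v < n" "X u < X v" "A u < A v" "Y v - Y u = A u * (X v - X u)"
    unfolding adj_def by (auto simp: min_def)
qed

text \<open>Slopes increase along a directed path, so it is a convex chain above the line of its start.\<close>

lemma arc_tranclpD:
  assumes G: "G \<subseteq> edges" and "(arc G)\<^sup>+\<^sup>+ u v"
  shows "X u < X v \<and> A u < A v \<and> A u * (X v - X u) \<le> Y v - Y u"
  using assms(2)
proof (induction rule: tranclp_induct)
  case (base v)
  then show ?case using arcD[OF G base] by simp
next
  case (step v w)
  note a = arcD[OF G step.hyps(2)]
  have "A u * (X w - X v) \<le> A v * (X w - X v)"
    using step.IH a by (intro mult_right_mono) auto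
  moreover have "A u * (X w - X u) = A u * (X w - X v) + A u * (X v - X u)"
    by (simp add: algebra_simps)
  ultimately have "A u * (X w - X u) \<le> Y w - Y u" using step.IH a(5) by linarith
  then show ?case using step.IH a by simp
qed

text \<open>Such a path meets \<open>z\<close> on or above the line of \<open>u\<close> and then
  climbs at average slope at least \<open>A z > A u\<close>. It ends strictly above that line, but
  the arc from \<open>u\<close> puts \<open>v\<close> on it.\<close>

lemma no_bypass:
  assumes G: "G \<subseteq> edges" and "arc G u v" "(arc G)\<^sup>+\<^sup>+ u z" "(arc G)\<^sup>+\<^sup>+ z v"
  shows False
proof -
  note a = arc_tranclpD[OF G assms(3)] arc_tranclpD[OF G assms(4)]
  have "A u * (X v - X z) < A z * (X v - X z)"
    using a by (intro mult_strict_right_mono) auto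
  moreover have "A u * (X v - X u) = A u * (X v - X z) + A u * (X z - X u)"
    by (simp add: algebra_simps)
  ultimately show False using a arcD(5)[OF G assms(2)] by linarith
qed

text \<open>The order is the transitive closure of \<open>arc G\<close>, irreflexive because
  \<open>X\<close> grows along arcs. A cover must be a single arc, and \<open>no_bypass\<close>
  makes every arc a cover.\<close>

lemma hasse_subgraph:
  assumes G: "G \<subseteq> edges"
  obtains H where "is_hasse_diagram H" "pverts H = {..<n}" "parcs H = {(u, v). {u, v} \<in> G}"
proof
  let ?lt = "(arc G)\<^sup>+\<^sup>+" and ?H = "cover_graph {..<n} (arc G)\<^sup>+\<^sup>+"
  have "strict_poset {..<n} ?lt"
    unfolding strict_poset_def
  proof
    show "irreflp_on {..<n} ?lt"
      using arc_tranclpD[OF G] by (intro irreflp_onI) blast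
    show "transp_on {..<n} ?lt" by (intro transp_onI) (rule tranclp_trans)
  qed
  then show "is_hasse_diagram ?H" unfolding is_hasse_diagram_def by blast
  show "pverts ?H = {..<n}" unfolding cover_graph_def by simp
  have cov: "covered_by {..<n} ?lt u v \<longleftrightarrow> arc G u v" for u v
  proof
    assume c: "covered_by {..<n} ?lt u v"
    then have "?lt u v" unfolding covered_by_def by simp
    then show "arc G u v"
    proof (cases rule: tranclp.cases)
      case (trancl_into_trancl z)
      then have "z < n" "?lt z v" using arcD(1)[OF G] by auto
      then show ?thesis using c trancl_into_trancl(1) unfolding covered_by_def by blast
    qed
  next
    assume a: "arc G u v"
    then show "covered_by {..<n} ?lt u v"
      using arcD(1,2)[OF G a] no_bypass[OF G a] unfolding covered_by_def by blast
  qed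
  have ne: "X u \<noteq> X v" if "{u, v} \<in> G" for u v
    using that G edge_iff[of u v] unfolding adj_def by auto
  have "arc G u v \<or> arc G v u \<longleftrightarrow> {u, v} \<in> G" for u v
    using ne[of u v] unfolding arc_def insert_commute[of v u] neq_iff by blast
  then show "parcs ?H = {(u, v). {u, v} \<in> G}"
    unfolding cover_graph_def by (simp add: cov)
qed

end

section \<open>A sparse subgraph with small independence number\<close>

text \<open>Turns the growth factor of the hard-core sum into an exponential, so that the union
  bound becomes a comparison of exponents.\<close>

lemma exp_third_le:
  fixes w :: real
  assumes "0 \<le> w" "w \<le> 1"
  shows "exp (w / 3) \<le> 1 + w / 2"
proof -
  have "exp (w / 3) \<le> 1 + w / 3 + (w / 3)\<^sup>2" by (rule exp_bound) (use assms in auto)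
  also have "(w / 3)\<^sup>2 \<le> w / 9" using assms by (simp add: power2_eq_square mult_left_le)
  finally show ?thesis using assms by simp
qed

lemma card_subsets_le_power:
  assumes "finite V"
  shows "card {I. I \<subseteq> V \<and> card I = s} \<le> card V ^ s"
proof (cases "s \<le> card V")
  case True
  then show ?thesis using assms binomial_le_pow by (simp add: n_subsets)
next
  case False
  then show ?thesis using assms by (simp add: n_subsets binomial_eq_0)
qed

context incidence_host
begin

section \<open>The weight of the short cycles through an edge\<close>

definition short_paths :: "nat \<Rightarrow> nat set \<Rightarrow> nat list set" where
  "short_paths k e = {vs. distinct vs \<and> 3 \<le> length vs \<and> length vs < k \<and> set vs \<subseteq> {..<n} \<and>
     path_edges vs \<subseteq> edges \<and> {last vs, hd vs} = e}"

lemma finite_short_paths: "finite (short_paths k e)"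
  by (rule finite_subset[OF _ finite_lists_length_le[of "{..<n}" k]]) (auto simp: short_paths_def)

lemma set_subset_of_path_edges:
  assumes "path_edges vs \<subseteq> edges" "2 \<le> length vs"
  shows "set vs \<subseteq> {..<n}"
proof
  fix v assume "v \<in> set vs"
  then obtain i where i: "i < length vs" "v = vs ! i" by (auto simp: in_set_conv_nth)
  obtain j where j: "Suc j < length vs" "v \<in> {vs ! j, vs ! Suc j}"
  proof (cases "Suc i < length vs")
    case False
    then show ?thesis using that[of "i - 1"] i assms(2) by (cases i) auto
  qed (use that i in auto)
  then have "{vs ! j, vs ! Suc j} \<in> edges" using assms(1) unfolding path_edges_def by blast
  then show "v \<in> {..<n}" using j unfolding edge_iff by auto
qed

text \<open>The path may start at either end of the edge, hence two sets of walks. Three vertices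
  would form a triangle, so the lengths run from \<open>4\<close> to \<open>k - 1\<close>.\<close>

lemma short_paths_subset_walks:
  assumes uv: "adj u v"
  shows "short_paths k {u, v} \<subseteq> (\<Union>r<k - 4. walks (r + 4) u v \<union> walks (r + 4) v u)"
proof
  fix vs assume vs: "vs \<in> short_paths k {u, v}"
  have "successively adj vs"
    unfolding successively_conv_nth
  proof (intro allI impI)
    fix i assume "Suc i < length vs"
    then have "{vs ! i, vs ! Suc i} \<in> edges"
      using vs unfolding short_paths_def path_edges_def by blast
    then show "adj (vs ! i) (vs ! Suc i)" unfolding edge_iff by simp
  qed
  moreover have "(hd vs = u \<and> last vs = v) \<or> (hd vs = v \<and> last vs = u)"
    using vs unfolding short_paths_def by (auto simp: doubleton_eq_iff)
  ultimately have w: "vs \<in> walks (length vs) u v \<union> walks (length vs) v u"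
    using vs unfolding short_paths_def walks_def by auto
  then have "length vs \<noteq> 3" using walks_3_empty uv adj_sym by auto
  then have "4 \<le> length vs" "length vs < k" using vs unfolding short_paths_def by auto
  define r where "r = length vs - 4"
  have "r < k - 4" "length vs = r + 4"
    using \<open>4 \<le> length vs\<close> \<open>length vs < k\<close> unfolding r_def by auto
  with w show "vs \<in> (\<Union>r<k - 4. walks (r + 4) u v \<union> walks (r + 4) v u)" by auto
qed

text \<open>In the total weight of the walks on \<open>r + 4\<close> vertices the powers of
  \<open>m\<close> cancel down to \<open>1 / m\<close>. The longest walks, with
  \<open>r = k - 5\<close>, yield the exponents \<open>2 * k - 7\<close> and \<open>k - 2\<close> of
  \<open>large\<close>; fewer than \<open>k\<close> lengths are summed.\<close>

lemma sum_short_paths_le: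
  fixes \<mu> :: real
  assumes k: "5 \<le> k" and \<mu>: "1 \<le> \<mu>" and m: "0 < m"
    and large: "16 * k * d ^ (2 * k - 7) * \<mu> ^ (k - 2) \<le> m" and e: "e \<in> edges"
  shows "(\<Sum>vs\<in>short_paths k e. (\<mu> / m) ^ (length vs - 1)) \<le> 1 / 2"
proof -
  let ?w = "\<mu> / real m"
  obtain u v where uv: "e = {u, v}" "adj u v" using e unfolding edges_def by auto
  have d: "1 \<le> real d" using d_pos by simp
  let ?W = "\<lambda>r. walks (r + 4) u v \<union> walks (r + 4) v u"
  have part: "(\<Sum>vs\<in>?W r. ?w ^ (length vs - 1)) \<le> 8 * d ^ (2 * k - 7) * \<mu> ^ (k - 2) / m"
    if r: "r < k - 4" for r
  proof -
    have "(\<Sum>vs\<in>?W r. ?w ^ (length vs - 1)) = (\<Sum>vs\<in>?W r. ?w ^ (r + 3))"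
      by (rule sum.cong) (auto simp: walks_def add.commute)
    also have "\<dots> = card (?W r) * ?w ^ (r + 3)" by simp
    also have "\<dots> \<le> (2 * ((d\<^sup>2 * m) ^ r * (4 * (d ^ 3 * m\<^sup>2)))) * ?w ^ (r + 3)"
    proof (rule mult_right_mono)
      have "card (?W r) \<le> card (walks (r + 4) u v) + card (walks (r + 4) v u)" by (rule card_Un_le)
      also have "\<dots> \<le> 2 * ((d\<^sup>2 * m) ^ r * (4 * (d ^ 3 * m\<^sup>2)))"
        using card_walks_le[of r u v] card_walks_le[of r v u] by linarith
      finally show "real (card (?W r)) \<le> real (2 * ((d\<^sup>2 * m) ^ r * (4 * (d ^ 3 * m\<^sup>2))))"
        by (rule of_nat_mono)
    qed (use \<mu> in auto)
    also have "\<dots> = 8 * (d ^ (2 * r + 3) * \<mu> ^ (r + 3)) / m"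
      using m by (simp add: power_add power_mult power_mult_distrib power_divide field_simps
          power2_eq_square power3_eq_cube)
    also have "\<dots> \<le> 8 * (d ^ (2 * k - 7) * \<mu> ^ (k - 2)) / m"
    proof (intro divide_right_mono mult_left_mono mult_mono)
      show "real (d ^ (2 * r + 3)) \<le> real (d ^ (2 * k - 7))"
        unfolding of_nat_power using d r by (intro power_increasing) auto
      show "\<mu> ^ (r + 3) \<le> \<mu> ^ (k - 2)" using \<mu> r by (intro power_increasing) auto
    qed (use \<mu> in auto)
    finally show ?thesis by simp
  qed
  have "(\<Sum>vs\<in>short_paths k e. ?w ^ (length vs - 1)) \<le> (\<Sum>vs\<in>(\<Union>r<k - 4. ?W r). ?w ^ (length vs - 1))"
    unfolding uv(1)
    by (rule sum_mono2[OF _ short_paths_subset_walks[OF uv(2)]]) (use \<mu> finite_walks in auto)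
  also have "\<dots> \<le> (\<Sum>r<k - 4. \<Sum>vs\<in>?W r. ?w ^ (length vs - 1))"
    by (rule sum_UN_le) (use \<mu> finite_walks in auto)
  also have "\<dots> \<le> (\<Sum>r<k - 4. 8 * d ^ (2 * k - 7) * \<mu> ^ (k - 2) / m)"
    by (intro sum_mono part) simp
  also have "\<dots> = (k - 4) * (8 * d ^ (2 * k - 7) * \<mu> ^ (k - 2) / m)" by simp
  also have "\<dots> \<le> k * (8 * d ^ (2 * k - 7) * \<mu> ^ (k - 2) / m)"
    by (rule mult_right_mono) (use \<mu> in auto)
  also have "\<dots> \<le> 1 / 2" using large m by (simp add: field_simps)
  finally show ?thesis .
qed

lemma exists_sparse_dense_subgraph:
  assumes k: "5 \<le> k" and n: "3 \<le> n" and m: "0 < m"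
    and large: "16 * k * d ^ (2 * k - 7) * (7 * ln n) ^ (k - 2) \<le> m"
  shows "\<exists>G\<subseteq>edges. no_short_cycle k G \<and> (\<forall>I\<subseteq>{..<n}. card I = 12 * m * d ^ 3 \<longrightarrow> (\<exists>e\<in>G. e \<subseteq> I))"
proof -
  \<comment> \<open>The factor 7 makes the union bound succeed: with
    \<open>t = m * d ^ 3 * ln n\<close>, there are at most \<open>exp (12 * t)\<close> sets of size
    \<open>?s\<close>, while \<open>6 * m\<^sup>2 * d ^ 3\<close> factors of at least
    \<open>exp (?w / 3)\<close> give \<open>exp (14 * t)\<close>.\<close>
  let ?\<mu> = "7 * ln (real n)" and ?s = "12 * m * d ^ 3"
  let ?w = "?\<mu> / m"
  have "exp 1 \<le> real n" using exp_le n by linarith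
  then have ln: "1 \<le> ln (real n)" using n by (subst ln_ge_iff) auto
  then have \<mu>: "1 \<le> ?\<mu>" by simp
  \<comment> \<open>This chain yields \<open>?w \<le> 1\<close>, which \<open>exp_third_le\<close>
    requires.\<close>
  have "?\<mu> \<le> ?\<mu> ^ (k - 2)" using \<mu> k by (intro self_le_power) auto
  also have "\<dots> \<le> 16 * k * d ^ (2 * k - 7) * ?\<mu> ^ (k - 2)"
  proof -
    have "1 \<le> 16 * k * d ^ (2 * k - 7)" using k d_pos by simp
    then have "1 \<le> real (16 * k * d ^ (2 * k - 7))" by linarith
    then have "1 * ?\<mu> ^ (k - 2) \<le> real (16 * k * d ^ (2 * k - 7)) * ?\<mu> ^ (k - 2)"
      by (rule mult_right_mono) (use \<mu> in simp)
    then show ?thesis by simp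
  qed
  finally have "?\<mu> \<le> m" using large by linarith
  then have w: "0 < ?w" "?w \<le> 1" using ln m by auto
  have "\<exists>G\<subseteq>edges. no_short_cycle k G \<and> (\<forall>I\<in>{I. I \<subseteq> {..<n} \<and> card I = ?s}. G \<inter> {e\<in>edges. e \<subseteq> I} \<noteq> {})"
  proof (rule exists_hitting_subset[where \<K> = "\<lambda>e. path_edges ` short_paths k e" and M = "6 * m\<^sup>2 * d ^ 3"])
    show "\<exists>K\<in>path_edges ` short_paths k e. K \<subseteq> G"
      if a: "G \<subseteq> edges" "e \<in> edges" "no_short_cycle k G" "\<not> no_short_cycle k (insert e G)" for e G
    proof -
      obtain vs where vs: "distinct vs" "3 \<le> length vs" "length vs < k" "path_edges vs \<subseteq> G" "{last vs, hd vs} = e"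
        using no_short_cycle_insert_obstruction[OF a(3,4)] by blast
      then have "vs \<in> short_paths k e"
        using a(1) set_subset_of_path_edges[of vs] unfolding short_paths_def by auto
      then show ?thesis using vs(4) by blast
    qed
    show "(\<Sum>K\<in>path_edges ` short_paths k e. ?w ^ card K) \<le> 1 / 2" if e: "e \<in> edges" for e
    proof -
      \<comment> \<open>A path and its reversal have the same edge set, so passing to paths gives
        only an upper bound.\<close>
      have "(\<Sum>K\<in>path_edges ` short_paths k e. ?w ^ card K)
          \<le> sum ((\<lambda>K. ?w ^ card K) \<circ> path_edges) (short_paths k e)"
        by (rule sum_image_le[OF finite_short_paths]) (use w in simp)
      also have "\<dots> = (\<Sum>vs\<in>short_paths k e. ?w ^ (length vs - 1))"
        by (rule sum.cong) (auto simp: short_paths_def card_path_edges)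
      also have "\<dots> \<le> 1 / 2" by (rule sum_short_paths_le[OF k \<mu> m large e])
      finally show ?thesis .
    qed
    show "6 * m\<^sup>2 * d ^ 3 \<le> card {e\<in>edges. e \<subseteq> I}" if "I \<in> {I. I \<subseteq> {..<n} \<and> card I = ?s}" for I
      using card_edges_within_ge[of I] that m by simp
    have "real (card {I. I \<subseteq> {..<n} \<and> card I = ?s}) \<le> real (n ^ ?s)"
      using card_subsets_le_power[of "{..<n}" ?s] by simp
    also have "\<dots> = exp (real ?s * ln (real n))" unfolding exp_of_nat_mult using n by simp
    also have "\<dots> < exp (real (6 * m\<^sup>2 * d ^ 3) * (?w / 3))"
    proof -
      define t where "t = m * d ^ 3 * ln n"
      have "real (6 * m\<^sup>2 * d ^ 3) * (?w / 3) = 14 * t" "real ?s * ln (real n) = 12 * t"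
        unfolding t_def using m by (simp_all add: field_simps power2_eq_square)
      moreover have "0 < t" unfolding t_def using m d_pos ln by simp
      ultimately show ?thesis unfolding exp_less_cancel_iff by linarith
    qed
    also have "\<dots> = exp (?w / 3) ^ (6 * m\<^sup>2 * d ^ 3)" by (rule exp_of_nat_mult)
    also have "\<dots> \<le> (1 + ?w / 2) ^ (6 * m\<^sup>2 * d ^ 3)"
      by (intro power_mono exp_third_le) (use w in auto)
    finally show "real (card {I. I \<subseteq> {..<n} \<and> card I = ?s}) < (1 + ?w / 2) ^ (6 * m\<^sup>2 * d ^ 3)" .
    show "finite K" if "K \<in> path_edges ` short_paths k e" for e K
      using that finite_path_edges by auto
    show "no_short_cycle k G'" if "no_short_cycle k G" "G' \<subseteq> G" for G G'
      using that by (rule no_short_cycle_subset)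
    show "finite {I. I \<subseteq> {..<n} \<and> card I = ?s}"
      by (rule finite_subset[of _ "Pow {..<n}"]) auto
  qed (use w(1) in \<open>auto simp: finite_edges finite_short_paths no_short_cycle_empty\<close>)
  then obtain G where G: "G \<subseteq> edges" "no_short_cycle k G"
    "\<And>I. I \<subseteq> {..<n} \<Longrightarrow> card I = ?s \<Longrightarrow> G \<inter> {e\<in>edges. e \<subseteq> I} \<noteq> {}" by blast
  have "\<exists>e\<in>G. e \<subseteq> I" if "I \<subseteq> {..<n}" "card I = ?s" for I using G(3)[OF that] by blast
  with G(1,2) show ?thesis by blast
qed

lemma exists_hasse_diagram:
  assumes k: "5 \<le> k" and n: "3 \<le> n" and m: "0 < m"
    and large: "16 * k * d ^ (2 * k - 7) * (7 * ln n) ^ (k - 2) \<le> m"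
  shows "\<exists>H :: nat pair_pre_digraph. pair_graph H \<and> card (pverts H) = n \<and> is_hasse_diagram H \<and>
    girth H \<ge> enat k \<and> n \<le> chromatic_number H * (12 * m * d ^ 3)"
proof -
  obtain G where G: "G \<subseteq> edges" "no_short_cycle k G"
    "\<And>I. I \<subseteq> {..<n} \<Longrightarrow> card I = 12 * m * d ^ 3 \<Longrightarrow> \<exists>e\<in>G. e \<subseteq> I"
    using exists_sparse_dense_subgraph[OF assms] by blast
  obtain H where H: "is_hasse_diagram H" "pverts H = {..<n}" "parcs H = {(u, v). {u, v} \<in> G}"
    using hasse_subgraph[OF G(1)] .
  have pg: "pair_graph H" by (rule is_hasse_diagram_imp_pair_graph[OF H(1)])
  obtain c where c: "proper_coloring H (chromatic_number H) c"
    using pair_graph.proper_coloring_chromatic_number[OF pg] by blast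
  have "card {..<n} \<le> chromatic_number H * (12 * m * d ^ 3)"
  proof (rule card_vertices_le_colors_mult[OF c H(2)])
    fix I assume "I \<subseteq> {..<n}" "card I = 12 * m * d ^ 3"
    then obtain e where e: "e \<in> G" "e \<subseteq> I" using G(3) by blast
    moreover obtain u v where "e = {u, v}" using e(1) G(1) unfolding edges_def by auto
    ultimately show "\<exists>(x, y)\<in>parcs H. x \<in> I \<and> y \<in> I" unfolding H(3) by auto
  qed simp
  moreover have "enat k \<le> girth H" by (rule girth_ge[OF G(2)]) (simp add: H(3))
  ultimately show ?thesis using pg H by (intro exI[of _ H]) auto
qed

end

section \<open>Choice of parameters\<close>

text \<open>The constant 48 is 12 from the size of the sets that must span an edge, times 2 for
  rounding \<open>m\<close> up, times 2 for rounding \<open>d\<close> down.\<close>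

lemma exists_large_chromatic_hasse_diagram:
  fixes k n :: nat
  defines "\<alpha> \<equiv> 1 / (2 * real k - 3)"
  assumes k: "5 \<le> k" and n: "3 \<le> n"
    and ln: "16 * real k * 7 ^ (k - 2) \<le> ln (real n)"
    and large: "1 \<le> real n powr \<alpha> / ln (real n)"
  shows "\<exists>H :: nat pair_pre_digraph. pair_graph H \<and> card (pverts H) = n \<and> is_hasse_diagram H \<and>
    girth H \<ge> enat k \<and> real n powr \<alpha> / (48 * ln (real n)) \<le> chromatic_number H"
proof -
  let ?L = "ln (real n)"
  \<comment> \<open>Dividing by the logarithm leaves room for \<open>?L ^ (2 * k - 3)\<close> in
    \<open>dpow\<close>, which pays for the logarithms and constants in the lower bound
    \<open>cond\<close> on \<open>m\<close>.\<close>
  define q where "q = real n powr \<alpha> / ?L"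
  define d where "d = nat \<lfloor>q\<rfloor>"
  define m where "m = n div d ^ 4 + 1"
  have "1 \<le> 16 * real k * 7 ^ (k - 2)"
    using k one_le_power[of "7::real" "k - 2"] mult_mono[of 1 "16 * real k" 1 "7 ^ (k - 2)"] by simp
  then have L: "1 \<le> ?L" using ln by linarith
  have "1 \<le> \<lfloor>q\<rfloor>" using large unfolding q_def[symmetric] by (simp only: le_floor_iff of_int_1)
  moreover from this have "real d = of_int \<lfloor>q\<rfloor>" unfolding d_def by simp
  ultimately have d1: "1 \<le> d" and d_le: "real d \<le> q" and d_ge: "q / 2 \<le> real d"
    by linarith+
  have "real d ^ (2 * k - 3) \<le> q ^ (2 * k - 3)" using d_le by (intro power_mono) auto
  also have "\<dots> = n / ?L ^ (2 * k - 3)"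
  proof -
    have "(real n powr \<alpha>) ^ (2 * k - 3) = real n powr (real (2 * k - 3) * \<alpha>)"
      using n by (subst powr_realpow[symmetric]) (auto simp: powr_powr mult.commute)
    also have "real (2 * k - 3) * \<alpha> = 1" unfolding \<alpha>_def using k by (simp add: of_nat_diff)
    finally show ?thesis using n by (simp add: q_def power_divide)
  qed
  finally have dpow: "real d ^ (2 * k - 3) * ?L ^ (2 * k - 3) \<le> n"
    using L by (simp add: field_simps)
  have d4: "d ^ 4 \<le> n"
  proof -
    have "real d ^ 4 \<le> real d ^ (2 * k - 3) * 1" using d1 k by (simp add: power_increasing)
    also have "\<dots> \<le> real d ^ (2 * k - 3) * ?L ^ (2 * k - 3)"
      using L by (intro mult_left_mono one_le_power) auto
    also note dpow
    finally have "real (d ^ 4) \<le> real n" by (simp only: of_nat_power)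
    then show ?thesis by (simp only: of_nat_le_iff)
  qed
  have n_m: "n \<le> m * d ^ 4"
  proof -
    have "n div d ^ 4 * d ^ 4 + n mod d ^ 4 = n" by (rule div_mult_mod_eq)
    moreover have "n mod d ^ 4 < d ^ 4" using d1 by simp
    moreover have "m * d ^ 4 = n div d ^ 4 * d ^ 4 + d ^ 4" by (simp add: m_def)
    ultimately show ?thesis by linarith
  qed
  have "real m \<le> 2 * (n / real d ^ 4)"
  proof -
    have "real (n div d ^ 4) \<le> n / real d ^ 4" using of_nat_div_le_of_nat[of n "d ^ 4"] by simp
    moreover have "1 \<le> n / real d ^ 4" using d4 d1 by (simp add: of_nat_le_iff[symmetric] del: of_nat_le_iff)
    ultimately show ?thesis unfolding m_def by simp
  qed
  then have m_le: "real m * real d ^ 4 \<le> 2 * n" using d1 by (simp add: field_simps)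
  have "16 * k * d ^ (2 * k - 7) * (7 * ?L) ^ (k - 2) * real d ^ 4
      = real d ^ (2 * k - 3) * (?L ^ (k - 2) * (16 * real k * 7 ^ (k - 2)))"
  proof -
    have "real d ^ (2 * k - 7) * real d ^ 4 = real d ^ (2 * k - 3)"
      using k by (simp add: power_add[symmetric])
    then show ?thesis by (simp add: power_mult_distrib)
  qed
  \<comment> \<open>One logarithm already absorbs the constant, by \<open>ln\<close>; the others
    bring the total exponent to \<open>2 * k - 3\<close>.\<close>
  also have "\<dots> \<le> real d ^ (2 * k - 3) * (?L ^ (k - 2) * ?L ^ (k - 1))"
  proof (intro mult_left_mono)
    have "?L \<le> ?L ^ (k - 1)" using L k by (intro self_le_power) auto
    with ln show "16 * real k * 7 ^ (k - 2) \<le> ?L ^ (k - 1)" by linarith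
  qed (use L in auto)
  also have "?L ^ (k - 2) * ?L ^ (k - 1) = ?L ^ (2 * k - 3)"
  proof -
    have "2 * k - 3 = (k - 2) + (k - 1)" using k by simp
    then show ?thesis by (simp only: power_add)
  qed
  also note dpow
  also have "real n \<le> real m * real d ^ 4" using of_nat_mono[OF n_m, where 'a = real] by simp
  finally have cond: "16 * k * d ^ (2 * k - 7) * (7 * ?L) ^ (k - 2) \<le> m"
    by (rule mult_right_le_imp_le) (use d1 in simp)
  interpret incidence_host d m n by unfold_locales (use d1 n_m in auto)
  obtain H :: "nat pair_pre_digraph" where H: "pair_graph H" "card (pverts H) = n" "is_hasse_diagram H"
    "girth H \<ge> enat k" "n \<le> chromatic_number H * (12 * m * d ^ 3)"
    using exists_hasse_diagram[OF k n _ cond] unfolding m_def by auto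
  let ?\<chi> = "real (chromatic_number H)"
  have "real n * d \<le> ?\<chi> * (12 * (real m * real d ^ 4))"
  proof -
    have "n * d \<le> chromatic_number H * (12 * m * d ^ 3) * d" using H(5) by (rule mult_le_mono1)
    then have "real (n * d) \<le> real (chromatic_number H * (12 * m * d ^ 3) * d)" by (rule of_nat_mono)
    then show ?thesis by (simp add: algebra_simps power3_eq_cube power_numeral_reduce)
  qed
  also have "\<dots> \<le> ?\<chi> * (12 * (2 * n))" using m_le by (intro mult_left_mono) auto
  finally have "real n * d \<le> real n * (24 * ?\<chi>)" by (simp add: algebra_simps)
  then have "d \<le> 24 * ?\<chi>" using n by simp
  then have "q / 48 \<le> ?\<chi>" using d_ge by linarith
  then show ?thesis using H by (intro exI[of _ H]) (simp add: q_def mult.commute)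
qed

text \<open>An antichain, whose cover graph has no edges; it serves the finitely many small
  \<open>n\<close>.\<close>

lemma exists_hasse_diagram_of_card:
  assumes "0 < n"
  shows "\<exists>H :: nat pair_pre_digraph. pair_graph H \<and> card (pverts H) = n \<and> is_hasse_diagram H \<and>
    girth H \<ge> enat k \<and> 1 \<le> chromatic_number H"
proof -
  let ?H = "cover_graph {..<n} (\<lambda>_ _. False)"
  have hasse: "is_hasse_diagram ?H"
    unfolding is_hasse_diagram_def strict_poset_def
    by (intro exI conjI) (auto intro: irreflp_onI transp_onI)
  have pg: "pair_graph ?H" by (rule is_hasse_diagram_imp_pair_graph[OF hasse])
  obtain c where c: "proper_coloring ?H (chromatic_number ?H) c"
    using pair_graph.proper_coloring_chromatic_number[OF pg] by blast
  have "1 \<le> chromatic_number ?H"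
    using c assms unfolding proper_coloring_def cover_graph_def by (auto simp: Suc_le_eq intro: le_less_trans)
  moreover have "enat k \<le> girth ?H"
    by (rule girth_ge[OF no_short_cycle_empty]) (simp add: cover_graph_def covered_by_def)
  ultimately show ?thesis using pg hasse by (intro exI[of _ ?H]) (simp add: cover_graph_def)
qed

theorem theorem2:
  fixes k :: nat
  assumes "k \<ge> 5"
  shows "\<exists>\<epsilon> :: nat \<Rightarrow> real. \<epsilon> \<longlonglongrightarrow> 0 \<and>
    (\<forall>n > 0. \<exists>G :: nat pair_pre_digraph.
       pair_graph G \<and> card (pverts G) = n \<and> is_hasse_diagram G \<and> girth G \<ge> enat k \<and>
       real (chromatic_number G) \<ge> real n powr (1 / (2 * real k - 3) + \<epsilon> n))"
proof -
  define \<alpha> where "\<alpha> = 1 / (2 * real k - 3)"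
  have \<alpha>: "0 < \<alpha>" "\<alpha> \<le> 1" unfolding \<alpha>_def using assms by auto
  have "eventually (\<lambda>n::nat. 16 * real k * 7 ^ (k - 2) \<le> ln (real n)) sequentially"
  proof -
    have "filterlim (\<lambda>n::nat. ln (real n)) at_top sequentially" by real_asymp
    then show ?thesis by (simp add: filterlim_at_top)
  qed
  moreover have "eventually (\<lambda>n::nat. 1 \<le> real n powr \<alpha> / ln (real n)) sequentially"
  proof -
    have "filterlim (\<lambda>n::nat. real n powr \<alpha> / ln (real n)) at_top sequentially"
      using \<alpha>(1) by real_asymp
    then show ?thesis by (simp add: filterlim_at_top)
  qed
  moreover have "eventually (\<lambda>n::nat. 3 \<le> n) sequentially" by (rule eventually_ge_at_top)
  ultimately have "eventually (\<lambda>n::nat. 16 * real k * 7 ^ (k - 2) \<le> ln (real n) \<and>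
      1 \<le> real n powr \<alpha> / ln (real n) \<and> 3 \<le> n) sequentially" by eventually_elim simp
  then obtain N where N: "\<And>n. N \<le> n \<Longrightarrow> 16 * real k * 7 ^ (k - 2) \<le> ln (real n)"
    "\<And>n. N \<le> n \<Longrightarrow> 1 \<le> real n powr \<alpha> / ln (real n)" "\<And>n. N \<le> n \<Longrightarrow> 3 \<le> n"
    unfolding eventually_sequentially by blast
  \<comment> \<open>For \<open>n < N\<close> the value \<open>-1\<close> makes the exponent at most
    \<open>0\<close>, so the antichain suffices. Otherwise \<open>n powr \<epsilon> n\<close> is
    exactly the lost factor \<open>1 / (48 * ln n)\<close>.\<close>
  define \<epsilon> :: "nat \<Rightarrow> real" where "\<epsilon> n = (if n < N then -1 else - ln (48 * ln n) / ln n)" for n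
  have "(\<lambda>n::nat. - ln (48 * ln (real n)) / ln (real n)) \<longlonglongrightarrow> 0" by real_asymp
  then have "\<epsilon> \<longlonglongrightarrow> 0"
    by (rule Lim_transform_eventually)
      (auto simp: \<epsilon>_def eventually_sequentially intro!: exI[of _ N])
  moreover have "\<exists>G :: nat pair_pre_digraph.
       pair_graph G \<and> card (pverts G) = n \<and> is_hasse_diagram G \<and> girth G \<ge> enat k \<and>
       real (chromatic_number G) \<ge> real n powr (\<alpha> + \<epsilon> n)" if n: "0 < n" for n
  proof (cases "n < N")
    case True
    then have "real n powr (\<alpha> + \<epsilon> n) \<le> real n powr 0"
      unfolding \<epsilon>_def using \<alpha>(2) n by (intro powr_mono) auto
    then have "real n powr (\<alpha> + \<epsilon> n) \<le> 1" using n by simp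
    moreover obtain G :: "nat pair_pre_digraph" where "pair_graph G" "card (pverts G) = n"
      "is_hasse_diagram G" "girth G \<ge> enat k" "1 \<le> chromatic_number G"
      using exists_hasse_diagram_of_card[OF n] by blast
    ultimately show ?thesis by (intro exI[of _ G]) simp
  next
    case False
    then have N': "N \<le> n" by simp
    have n3: "3 \<le> n" by (rule N(3)[OF N'])
    have "0 < ln (real n)" using n3 by simp
    then have "real n powr \<epsilon> n = 1 / (48 * ln (real n))"
      using False n3 unfolding \<epsilon>_def powr_def by (simp add: exp_minus field_simps)
    then have "real n powr (\<alpha> + \<epsilon> n) = real n powr \<alpha> / (48 * ln (real n))"
      by (simp add: powr_add)
    then show ?thesis
      using exists_large_chromatic_hasse_diagram[OF assms n3 N(1)[OF N'] N(2)[OF N', unfolded \<alpha>_def]]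
      unfolding \<alpha>_def by simp
  qed
  ultimately show ?thesis unfolding \<alpha>_def by blast
qed

end
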